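(* Let $\Omega$ and $V$ be domains of finite volume in $\mathbb{C}^n$, and let $f=(f_1,\dots,f_n):\Omega\to V$ be a biholomorphism between them. Then $V$ is a QDP if and only if for each multi-index $\alpha$, the function $uf^\alpha$ is in the Bergman span of $\Omega$, where $u$ is the complex Jacobian determinant of $f$ and $f^\alpha=f_1^{\alpha_1}\cdots f_n^{\alpha_n}$.
   Context: A domain is a nonempty connected open set. For a domain $\Omega\subset\mathbb{C}^n$ ($n\ge1$), $H^2(\Omega)$ is the Bergman space of holomorphic functions on $\Omega$ square-integrable with respect to Lebesgue measure, and $K(z,w)$ is its Bergman kernel: holomorphic in $z$, antiholomorphic in $w$, with $\int_\Omega f(w)K(z,w)\,dV(w)=f(z)$ for all $f\in H^2(\Omega)$. The Bergman span of $\Omega$ is the complex linear span of the functions $z\mapsto\frac{\partial^\alpha}{\partial\bar w^\alpha}K(z,w)|_{w=w_0}$, where $\alpha$ ranges over multi-indices and $w_0$ ranges over $\Omega$. A domain of finite volume is a quadrature domain (for $H^2$ functions) if the constant function $1$ is in its Bergman span. A QDP is a quadrature domain such that every holomorphic polynomial (restricted to the domain) is in its Bergman span. *)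

theory Defs
  imports "HOL-Analysis.Analysis"
begin

text \<open>Complex \<open>n\<close>-space is \<open>complex ^ 'n\<close> with \<open>n = CARD('n) \<ge> 1\<close>; multi-indices are functions
  \<open>'n \<Rightarrow> nat\<close>; Lebesgue measure is \<open>lborel\<close>.\<close>

definition domain_cn :: "(complex ^ 'n) set \<Rightarrow> bool" where
  "domain_cn \<Omega> \<longleftrightarrow> open \<Omega> \<and> connected \<Omega> \<and> \<Omega> \<noteq> {}"

definition finite_volume :: "(complex ^ 'n) set \<Rightarrow> bool" where
  "finite_volume \<Omega> \<longleftrightarrow> emeasure lborel \<Omega> < \<infinity>"

text \<open>Holomorphy in several variables, for use on open sets: the real Frechet derivative exists at
  every point and is complex linear.\<close>

definition holomorphic_cn :: "(complex ^ 'n \<Rightarrow> complex) \<Rightarrow> (complex ^ 'n) set \<Rightarrow> bool" where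
  "holomorphic_cn f \<Omega> \<longleftrightarrow>
     (\<forall>z\<in>\<Omega>. \<exists>a :: complex ^ 'n. (f has_derivative (\<lambda>h. \<Sum>j\<in>UNIV. a $ j * h $ j)) (at z))"

definition holomorphic_map :: "(complex ^ 'n \<Rightarrow> complex ^ 'n) \<Rightarrow> (complex ^ 'n) set \<Rightarrow> bool" where
  "holomorphic_map f \<Omega> \<longleftrightarrow> (\<forall>i. holomorphic_cn (\<lambda>z. f z $ i) \<Omega>)"

definition biholomorphism ::
  "(complex ^ 'n \<Rightarrow> complex ^ 'n) \<Rightarrow> (complex ^ 'n) set \<Rightarrow> (complex ^ 'n) set \<Rightarrow> bool" where
  "biholomorphism f \<Omega> V \<longleftrightarrow>
     bij_betw f \<Omega> V \<and> holomorphic_map f \<Omega> \<and> holomorphic_map (inv_into \<Omega> f) V"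

definition jacobian_det :: "(complex ^ 'n \<Rightarrow> complex ^ 'n) \<Rightarrow> complex ^ 'n \<Rightarrow> complex" where
  "jacobian_det f z = det (\<chi> i j. deriv (\<lambda>t. f (z + axis j t) $ i) 0)"

definition monomial_cn :: "('n::finite \<Rightarrow> nat) \<Rightarrow> complex ^ 'n \<Rightarrow> complex" where
  "monomial_cn \<alpha> z = (\<Prod>j\<in>UNIV. (z $ j) ^ \<alpha> j)"

definition polynomial_cn :: "(complex ^ 'n \<Rightarrow> complex) \<Rightarrow> bool" where
  "polynomial_cn p \<longleftrightarrow>
     (\<exists>A c. finite A \<and> p = (\<lambda>z. \<Sum>\<alpha>\<in>A. c \<alpha> * monomial_cn \<alpha> z))"

definition bergman_space :: "(complex ^ 'n) set \<Rightarrow> (complex ^ 'n \<Rightarrow> complex) set" where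
  "bergman_space \<Omega> =
     {f. holomorphic_cn f \<Omega> \<and> set_integrable lborel \<Omega> (\<lambda>z. (cmod (f z))\<^sup>2)}"

text \<open>The reproducing property determines \<open>K\<close> only when the conjugate of \<open>K z\<close> itself lies in the
  Bergman space; this is part of the usual definition and contains antiholomorphy in \<open>w\<close>. The
  kernel is then unique on \<open>\<Omega> \<times> \<Omega>\<close> and exists on every domain; values elsewhere are
  irrelevant.\<close>

definition is_bergman_kernel ::
  "(complex ^ 'n) set \<Rightarrow> (complex ^ 'n \<Rightarrow> complex ^ 'n \<Rightarrow> complex) \<Rightarrow> bool" where
  "is_bergman_kernel \<Omega> K \<longleftrightarrow>
     (\<forall>w\<in>\<Omega>. holomorphic_cn (\<lambda>z. K z w) \<Omega>) \<and>
     (\<forall>z\<in>\<Omega>. (\<lambda>w. cnj (K z w)) \<in> bergman_space \<Omega>) \<and>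
     (\<forall>f\<in>bergman_space \<Omega>. \<forall>z\<in>\<Omega>. (LINT w:\<Omega>|lborel. f w * K z w) = f z)"

text \<open>Wirtinger derivative with respect to the conjugate of the \<open>j\<close>-th variable \<open>x + i y\<close>:
  half of \<open>\<partial>/\<partial>x + i \<partial>/\<partial>y\<close>.\<close>

definition wirtinger_bar :: "'n \<Rightarrow> (complex ^ 'n \<Rightarrow> complex) \<Rightarrow> complex ^ 'n \<Rightarrow> complex" where
  "wirtinger_bar j g w =
     (vector_derivative (\<lambda>t. g (w + axis j (of_real t))) (at 0)
      + \<i> * vector_derivative (\<lambda>t. g (w + axis j (\<i> * of_real t))) (at 0)) / 2"

text \<open>The list enumerates the differentiations to perform, \<open>\<alpha> j\<close> of them in direction \<open>j\<close>. Their
  order is immaterial for antiholomorphic functions, whose derivatives commute.\<close>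

definition multi_wirtinger_bar ::
  "('n::finite \<Rightarrow> nat) \<Rightarrow> (complex ^ 'n \<Rightarrow> complex) \<Rightarrow> complex ^ 'n \<Rightarrow> complex" where
  "multi_wirtinger_bar \<alpha> g =
     foldr wirtinger_bar (SOME js. \<forall>j. count_list js j = \<alpha> j) g"

text \<open>The span consists of functions on \<open>\<Omega>\<close>: membership depends only on the values on \<open>\<Omega>\<close>.
  The existential over \<open>K\<close> ranges over representatives of the one kernel of \<open>\<Omega>\<close>.\<close>

definition bergman_span :: "(complex ^ 'n) set \<Rightarrow> (complex ^ 'n \<Rightarrow> complex) set" where
  "bergman_span \<Omega> =
     {h. \<exists>K. is_bergman_kernel \<Omega> K \<and>
        (\<exists>S c. finite S \<and> S \<subseteq> UNIV \<times> \<Omega> \<and>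
           (\<forall>z\<in>\<Omega>. h z = (\<Sum>(\<alpha>, w)\<in>S. c \<alpha> w * multi_wirtinger_bar \<alpha> (K z) w)))}"

definition quadrature_domain :: "(complex ^ 'n) set \<Rightarrow> bool" where
  "quadrature_domain \<Omega> \<longleftrightarrow>
     domain_cn \<Omega> \<and> finite_volume \<Omega> \<and> (\<lambda>z. 1) \<in> bergman_span \<Omega>"

definition QDP :: "(complex ^ 'n) set \<Rightarrow> bool" where
  "QDP \<Omega> \<longleftrightarrow> quadrature_domain \<Omega> \<and> (\<forall>p. polynomial_cn p \<longrightarrow> p \<in> bergman_span \<Omega>)"

end

theory Submission
  imports Defs "HOL-Complex_Analysis.Cauchy_Integral_Formula"
begin

text \<open>A biholomorphism \<open>f\<close> with Jacobian determinant \<open>u\<close> acts by \<open>F \<mapsto> u (F \<circ> f)\<close> from the Bergman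
  space of \<open>V\<close> onto that of \<open>\<Omega>\<close>, because the real Jacobian of \<open>f\<close> is \<open>\<bar>u\<bar>\<^sup>2\<close>. Hence the kernels are related by
  \<open>K\<^sub>\<Omega>(z, w) = u(z) K\<^sub>V(f z, f w) cnj(u(w))\<close>. Differentiating this identity in \<open>w\<close>, the chain
  rule expresses \<open>u(z)\<close> times a derivative of \<open>K\<^sub>V(f z, \<sqdot>)\<close> as a combination of derivatives of
  \<open>K\<^sub>\<Omega>(z, \<sqdot>)\<close> with coefficients that do not depend on \<open>z\<close>. So the same action maps the Bergman span
  of \<open>V\<close> into that of \<open>\<Omega>\<close>, and the inverse of \<open>f\<close> gives the converse. It suffices to
  consider monomials, because the kernel is unique and the span is therefore a linear space.\<close>

section \<open>Partial derivatives of holomorphic functions\<close>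

text \<open>The sketch relies on two facts that take most of the work. The first is regularity:
  holomorphy is assumed only as a complex linear derivative at each point, while iterated
  derivatives of the kernel require that partial derivatives are again holomorphic and commute. Both
  follow from Cauchy's formula on a circle in one coordinate direction, differentiated under the
  integral sign. The second is the identity between the absolute real determinant and the squared
  modulus of the complex one. Both sides are nonnegative multiplicative functions of a complex
  matrix with the same values on diagonal matrices, and Gaussian elimination shows that such a
  function is unique. The encoding adds an obstacle: \<open>multi_wirtinger_bar\<close>
  differentiates along an unspecified list, and \<open>bergman_span\<close> allows any
  representative of the kernel. Conjugation turns Wirtinger derivatives into iterated
  \<open>partial_cn\<close> of holomorphic functions, where the order is immaterial. All identities
  hold on the domains only, so each passage to derivatives uses openness.\<close>

definition partial_cn :: "'n \<Rightarrow> (complex ^ 'n \<Rightarrow> complex) \<Rightarrow> complex ^ 'n \<Rightarrow> complex" where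
  "partial_cn j f z = deriv (\<lambda>t. f (z + axis j t)) 0"

lemma norm_axis_cn: "norm (axis j c :: complex ^ 'n) = cmod c"
  by (simp add: norm_vec_def L2_set_def axis_def if_distrib[of norm] if_distrib[of "\<lambda>x. x^2"] cong: if_cong)

lemma bounded_linear_axis: "bounded_linear (axis j :: complex \<Rightarrow> complex ^ 'n)"
proof (rule bounded_linear_intro[where K=1])
  show "axis j (x + y) = axis j x + (axis j y :: complex ^ 'n)" for x y
    by (simp add: vec_eq_iff axis_def)
  show "axis j (c *\<^sub>R x) = c *\<^sub>R (axis j x :: complex ^ 'n)" for c x
    by (simp add: vec_eq_iff axis_def)
  show "norm (axis j x :: complex ^ 'n) \<le> norm x * 1" for x
    by (simp add: norm_axis_cn)
qed

lemma has_derivative_axis: "((\<lambda>t. z + axis j t) has_derivative (axis j :: complex \<Rightarrow> complex ^ 'n)) F"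
  using has_derivative_add[OF has_derivative_const[of z F] bounded_linear_imp_has_derivative[OF bounded_linear_axis]] by simp

lemma sum_mult_axis: "(\<Sum>k\<in>UNIV. a k * (axis j t :: complex ^ 'n) $ k) = a j * t"
  by (simp add: axis_def if_distrib cong: if_cong)

lemma has_derivative_imp_axis_derivative:
  fixes z :: "complex ^ 'n"
  assumes "(f has_derivative (\<lambda>h. \<Sum>k\<in>UNIV. a k * h $ k)) (at (z + axis j t))"
  shows "((\<lambda>t. f (z + axis j t)) has_field_derivative a j) (at t)"
proof -
  have "(f \<circ> (\<lambda>t. z + axis j t) has_derivative (\<lambda>h. \<Sum>k\<in>UNIV. a k * h $ k) \<circ> axis j) (at t)"
    by (rule diff_chain_at[OF has_derivative_axis assms])
  then show ?thesis
    by (simp add: o_def sum_mult_axis has_field_derivative_def)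
qed

lemma partial_cn_eqI:
  fixes z :: "complex ^ 'n"
  assumes "(f has_derivative (\<lambda>h. \<Sum>k\<in>UNIV. a k * h $ k)) (at z)"
  shows "partial_cn j f z = a j"
  unfolding partial_cn_def
  by (rule DERIV_imp_deriv[OF has_derivative_imp_axis_derivative]) (simp add: assms axis_def vec_eq_iff
     flip: zero_vec_def)

lemma holomorphic_cnI:
  assumes "\<And>z. z \<in> \<Omega> \<Longrightarrow> (f has_derivative (\<lambda>h. \<Sum>k\<in>UNIV. a z k * h $ k)) (at z)"
  shows "holomorphic_cn f \<Omega>"
  unfolding holomorphic_cn_def
proof
  fix z assume "z \<in> \<Omega>"
  from assms[OF this] show "\<exists>a :: complex ^ 'a. (f has_derivative (\<lambda>h. \<Sum>j\<in>UNIV. a $ j * h $ j)) (at z)"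
    by (intro exI[of _ "\<chi> k. a z k"]) simp
qed

lemma holomorphic_cn_has_derivative:
  assumes "holomorphic_cn f \<Omega>" "z \<in> \<Omega>"
  shows "(f has_derivative (\<lambda>h. \<Sum>k\<in>UNIV. partial_cn k f z * h $ k)) (at z)"
proof -
  obtain a :: "complex ^ 'a" where a: "(f has_derivative (\<lambda>h. \<Sum>j\<in>UNIV. a $ j * h $ j)) (at z)"
    using assms by (auto simp: holomorphic_cn_def)
  with partial_cn_eqI[OF a] show ?thesis by simp
qed

lemma holomorphic_cn_axis_derivative:
  assumes "holomorphic_cn f \<Omega>" "z + axis j t \<in> \<Omega>"
  shows "((\<lambda>t. f (z + axis j t)) has_field_derivative partial_cn j f (z + axis j t)) (at t)"
  by (rule has_derivative_imp_axis_derivative[OF holomorphic_cn_has_derivative[OF assms]])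

lemma holomorphic_cn_continuous_on: "holomorphic_cn f \<Omega> \<Longrightarrow> continuous_on \<Omega> f"
  by (meson continuous_at_imp_continuous_on has_derivative_continuous holomorphic_cn_has_derivative)

lemma has_derivative_cn_transform:
  assumes "(f has_derivative D) (at z)" "open \<Omega>" "z \<in> \<Omega>" "\<And>z. z \<in> \<Omega> \<Longrightarrow> f z = g z"
  shows "(g has_derivative D) (at z)"
  using has_derivative_transform_within_open[OF assms(1-3)] assms(4) by auto

lemma partial_cn_cong:
  assumes "holomorphic_cn f \<Omega>" "open \<Omega>" "\<And>z. z \<in> \<Omega> \<Longrightarrow> f z = g z" "z \<in> \<Omega>"
  shows "partial_cn j f z = partial_cn j g z"
  by (rule sym, rule partial_cn_eqI[OF has_derivative_cn_transform[OF holomorphic_cn_has_derivative[OF assms(1,4)] assms(2,4,3)]])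

text \<open>Cauchy's derivative formula for the slice in direction \<open>j\<close>: the speed of
  the circle contributes \<open>2 pi i\<close> times the radius vector, which cancels the constant
  and one power of the squared denominator. The derivative is thus expressed by values of
  \<open>f\<close> alone.\<close>

lemma partial_cn_circle_integral:
  fixes z :: "complex ^ 'n"
  assumes hol: "holomorphic_cn f \<Omega>" and sub: "cball z r \<subseteq> \<Omega>" and r: "r > 0"
  shows "partial_cn j f z =
    integral {0..1} (\<lambda>t. f (z + axis j (of_real r * exp (2 * of_real pi * \<i> * of_real t)))
       / (of_real r * exp (2 * of_real pi * \<i> * of_real t)))"
proof -
  let ?\<phi> = "\<lambda>t. f (z + axis j t)"
  have mem: "z + axis j t \<in> \<Omega>" if "t \<in> cball 0 r" for t
    using that sub by (auto simp: norm_axis_cn dist_norm intro!: subsetD[OF sub])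
  have der: "(?\<phi> has_field_derivative partial_cn j f (z + axis j t)) (at t)" if "t \<in> cball 0 r" for t
    by (rule holomorphic_cn_axis_derivative[OF hol mem[OF that]])
  have c: "continuous_on (cball 0 r) ?\<phi>"
    by (rule continuous_at_imp_continuous_on, rule, rule DERIV_isCont, rule der)
  have h: "?\<phi> holomorphic_on ball 0 r"
    unfolding holomorphic_on_open[OF open_ball] using der ball_subset_cball by blast
  have "deriv ?\<phi> 0 = 1 / (2 * of_real pi * \<i>) * contour_integral (circlepath 0 r) (\<lambda>u. ?\<phi> u / (u - 0)^2)"
    by (rule DERIV_imp_deriv, rule Cauchy_derivative_integral_circlepath(2)[OF c h]) (use r in simp)
  also have "\<dots> = 1 / (2 * of_real pi * \<i>) * integral {0..1} (\<lambda>t. 2 * of_real pi * \<i> * (f (z + axis j (of_real r * exp (2 * of_real pi * \<i> * of_real t)))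
       / (of_real r * exp (2 * of_real pi * \<i> * of_real t))))"
    unfolding contour_integral_integral vector_derivative_circlepath
    by (rule arg_cong2[where f="(*)"], simp, rule integral_cong)
       (use r in \<open>auto simp: circlepath power2_eq_square field_simps\<close>)
  also have "\<dots> = integral {0..1} (\<lambda>t. f (z + axis j (of_real r * exp (2 * of_real pi * \<i> * of_real t)))
       / (of_real r * exp (2 * of_real pi * \<i> * of_real t)))"
    unfolding integral_mult_right by simp
  finally show ?thesis by (simp add: partial_cn_def)
qed

text \<open>Half the radius of a ball inside the domain serves every centre in the smaller ball. The
  integral formulas near \<open>z0\<close> then share one radius, and the centre becomes a mere
  parameter.\<close>

lemma circle_nbhd:
  fixes z0 :: "complex ^ 'n"
  assumes "open \<Omega>" "z0 \<in> \<Omega>"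
  obtains r where "r > 0" "\<And>z. z \<in> ball z0 r \<Longrightarrow> cball z r \<subseteq> \<Omega>"
    "\<And>z j t. z \<in> ball z0 r \<Longrightarrow> z + axis j (of_real r * exp (2 * of_real pi * \<i> * of_real t)) \<in> \<Omega>"
proof -
  obtain e where e: "e > 0" "ball z0 e \<subseteq> \<Omega>" using assms openE by blast
  define r where "r = e / 2"
  have 1: "cball z r \<subseteq> \<Omega>" if "z \<in> ball z0 r" for z
  proof
    fix y assume "y \<in> cball z r"
    with that have "y \<in> ball z0 e"
      using dist_triangle[of z0 y z] by (auto simp: r_def field_simps)
    with e show "y \<in> \<Omega>" by blast
  qed
  show ?thesis
  proof
    show "r > 0" using e by (simp add: r_def)
    show "z + axis j (of_real r * exp (2 * of_real pi * \<i> * of_real t)) \<in> \<Omega>" if "z \<in> ball z0 r" for z j t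
      using \<open>r > 0\<close> by (intro subsetD[OF 1[OF that]]) (simp add: dist_norm norm_axis_cn norm_mult)
  qed (use 1 in blast)
qed

lemma continuous_circle_integrand:
  fixes f :: "complex ^ 'n \<Rightarrow> complex" and j :: 'n
  assumes "continuous_on \<Omega> f" "r > 0"
    and "\<And>z j t. z \<in> U \<Longrightarrow> z + axis j (of_real r * exp (2 * of_real pi * \<i> * of_real t)) \<in> \<Omega>"
  shows "continuous_on (U \<times> T) (\<lambda>(z, t). f (z + axis j (of_real r * exp (2 * of_real pi * \<i> * of_real t)))
       / (of_real r * exp (2 * of_real pi * \<i> * of_real t)))"
  unfolding case_prod_unfold
proof (intro continuous_intros)
  have ax: "continuous_on UNIV (axis j :: complex \<Rightarrow> complex ^ 'n)"
    using has_derivative_axis[of 0 j] by (auto intro!: continuous_at_imp_continuous_on has_derivative_continuous)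
  show "continuous_on (U \<times> T) (\<lambda>x. f (fst x + axis j (of_real r * exp (2 * of_real pi * \<i> * of_real (snd x)))))"
    by (rule continuous_on_compose2[OF assms(1)])
       (use assms in \<open>auto intro!: continuous_intros continuous_on_compose2[OF ax]\<close>)
qed (use assms in auto)

text \<open>An integral depends continuously on its parameter. Continuity has to precede holomorphy,
  because the Leibniz rule below asks for a jointly continuous derivative of the integrand.\<close>

lemma continuous_on_partial_cn:
  fixes \<Omega> :: "(complex ^ 'n) set"
  assumes hol: "holomorphic_cn f \<Omega>" and op: "open \<Omega>"
  shows "continuous_on \<Omega> (partial_cn j f)"
proof (rule continuous_at_imp_continuous_on, rule)
  fix z0 assume "z0 \<in> \<Omega>"
  then obtain r where r: "r > 0" "\<And>z. z \<in> ball z0 r \<Longrightarrow> cball z r \<subseteq> \<Omega>"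
    "\<And>z j t. z \<in> ball z0 r \<Longrightarrow> z + axis j (of_real r * exp (2 * of_real pi * \<i> * of_real t)) \<in> \<Omega>"
    using circle_nbhd[OF op, of z0] by blast
  have "continuous_on (ball z0 r) (\<lambda>z. integral (cbox 0 1) (\<lambda>t. f (z + axis j (of_real r * exp (2 * of_real pi * \<i> * of_real t)))
       / (of_real r * exp (2 * of_real pi * \<i> * of_real t))))"
    by (rule integral_continuous_on_param, rule continuous_circle_integrand[OF holomorphic_cn_continuous_on[OF hol] r(1,3)])
  then have "continuous_on (ball z0 r) (partial_cn j f)"
    by (rule continuous_on_eq) (use partial_cn_circle_integral[OF hol r(2) r(1)] in auto)
  then show "isCont (partial_cn j f) z0"
    using r(1) by (simp add: continuous_on_eq_continuous_at)
qed

lemma has_derivative_cn_integral: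
  fixes F :: "complex ^ 'n \<Rightarrow> real \<Rightarrow> complex"
  assumes der: "\<And>z t. z \<in> U \<Longrightarrow> ((\<lambda>z. F z t) has_derivative (\<lambda>h. \<Sum>k\<in>UNIV. G k z t * h $ k)) (at z)"
    and contF: "continuous_on (U \<times> cbox a b) (\<lambda>(z, t). F z t)"
    and contG: "\<And>k. continuous_on (U \<times> cbox a b) (\<lambda>(z, t). G k z t)"
    and U: "open U" "convex U" "z0 \<in> U"
  shows "((\<lambda>z. integral (cbox a b) (F z)) has_derivative (\<lambda>h. \<Sum>k\<in>UNIV. integral (cbox a b) (G k z0) * h $ k)) (at z0)"
proof -
  \<comment> \<open>The Leibniz rule wants the derivative as one continuous family of bounded linear
    maps; continuity of the family is then checked on each vector separately.\<close>
  define D where "D = (\<lambda>z t. Blinfun (\<lambda>h :: complex ^ 'n. \<Sum>k\<in>UNIV. G k z t * h $ k))"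
  have bl: "bounded_linear (\<lambda>h :: complex ^ 'n. \<Sum>k\<in>UNIV. a k * h $ k)" for a
    by (intro bounded_linear_sum bounded_linear_const_mult bounded_linear_vec_nth)
  have D: "blinfun_apply (D z t) = (\<lambda>h. \<Sum>k\<in>UNIV. G k z t * h $ k)" for z t
    unfolding D_def by (rule bounded_linear_Blinfun_apply[OF bl])
  have slice: "continuous_on T (\<lambda>t. H z t)" if "continuous_on (U \<times> T) (\<lambda>(z, t). H z t)" "z \<in> U"
    for H :: "complex ^ 'n \<Rightarrow> real \<Rightarrow> 'b::topological_space" and T z
    using continuous_on_compose2[OF that(1) continuous_on_Pair[OF continuous_on_const continuous_on_id], of z T] that(2)
    by (simp add: image_subset_iff)
  have contD: "continuous_on (U \<times> cbox a b) (\<lambda>(z, t). D z t)"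
    unfolding case_prod_unfold
  proof (rule continuous_on_blinfun_componentwise)
    show "continuous_on (U \<times> cbox a b) (\<lambda>x. blinfun_apply (D (fst x) (snd x)) i)" for i
      unfolding D by (intro continuous_on_sum continuous_on_mult_right contG[unfolded case_prod_unfold])
  qed
  have "((\<lambda>z. integral (cbox a b) (F z)) has_derivative blinfun_apply (integral (cbox a b) (D z0))) (at z0 within U)"
  proof (rule leibniz_rule[OF _ _ contD U(3,2)])
    show "((\<lambda>z. F z t) has_derivative blinfun_apply (D z t)) (at z within U)" if "z \<in> U" for z t
      unfolding D by (rule has_derivative_at_withinI[OF der[OF that]])
    show "F z integrable_on cbox a b" if "z \<in> U" for z
      by (rule integrable_continuous[OF slice[OF contF that]])
  qed
  moreover have "blinfun_apply (integral (cbox a b) (D z0)) = (\<lambda>h. \<Sum>k\<in>UNIV. integral (cbox a b) (G k z0) * h $ k)"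
  proof
    fix h
    have "blinfun_apply (integral (cbox a b) (D z0)) h = integral (cbox a b) (\<lambda>t. blinfun_apply (D z0 t) h)"
      by (rule blinfun_apply_integral, rule integrable_continuous, rule slice[OF contD U(3)])
    also have "\<dots> = (\<Sum>k\<in>UNIV. integral (cbox a b) (\<lambda>t. G k z0 t * h $ k))"
      unfolding D
      by (rule integral_sum) (simp, intro integrable_continuous continuous_on_mult_right slice[OF contG U(3)])
    also have "\<dots> = (\<Sum>k\<in>UNIV. integral (cbox a b) (G k z0) * h $ k)"
      by simp
    finally show "blinfun_apply (integral (cbox a b) (D z0)) h = (\<Sum>k\<in>UNIV. integral (cbox a b) (G k z0) * h $ k)" .
  qed
  ultimately show ?thesis
    using U by (simp add: at_within_open[of z0 U])
qed

text \<open>Differentiation of Cauchy's formula under the integral sign. The coefficients are kept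
  as explicit integrals because their form yields the symmetry of second derivatives.\<close>

lemma has_derivative_partial_cn:
  fixes \<Omega> :: "(complex ^ 'n) set"
  assumes hol: "holomorphic_cn f \<Omega>" and op: "open \<Omega>" and z0: "z0 \<in> \<Omega>"
  obtains r where "r > 0" "cball z0 r \<subseteq> \<Omega>"
    "(partial_cn j f has_derivative (\<lambda>h. \<Sum>k\<in>UNIV. integral {0..1} (\<lambda>t. partial_cn k f (z0 + axis j (of_real r * exp (2 * of_real pi * \<i> * of_real t)))
       / (of_real r * exp (2 * of_real pi * \<i> * of_real t))) * h $ k)) (at z0)"
proof -
  obtain r where r: "r > 0" "\<And>z. z \<in> ball z0 r \<Longrightarrow> cball z r \<subseteq> \<Omega>"
    "\<And>z j t. z \<in> ball z0 r \<Longrightarrow> z + axis j (of_real r * exp (2 * of_real pi * \<i> * of_real t)) \<in> \<Omega>"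
    using circle_nbhd[OF op z0] by blast
  define e where "e t = of_real r * exp (2 * of_real pi * \<i> * of_real t)" for t :: real
  have z0r: "z0 \<in> ball z0 r" using r by simp
  have mem: "z + axis j (e t) \<in> \<Omega>" if "z \<in> ball z0 r" for z t
    unfolding e_def by (rule r(3)[OF that])
  have "((\<lambda>z. integral (cbox 0 1) (\<lambda>t. f (z + axis j (e t)) / e t)) has_derivative
      (\<lambda>h. \<Sum>k\<in>UNIV. integral (cbox 0 1) (\<lambda>t. partial_cn k f (z0 + axis j (e t)) / e t) * h $ k)) (at z0)"
  proof (rule has_derivative_cn_integral[OF _ _ _ open_ball convex_ball z0r])
    show "continuous_on (ball z0 r \<times> cbox 0 1) (\<lambda>(z, t). f (z + axis j (e t)) / e t)"
      unfolding e_def by (rule continuous_circle_integrand[OF holomorphic_cn_continuous_on[OF hol] r(1,3)])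
    show "continuous_on (ball z0 r \<times> cbox 0 1) (\<lambda>(z, t). partial_cn k f (z + axis j (e t)) / e t)" for k
      unfolding e_def by (rule continuous_circle_integrand[OF continuous_on_partial_cn[OF hol op] r(1,3)])
    fix z :: "complex ^ 'n" and t :: real assume z: "z \<in> ball z0 r"
    have "((\<lambda>z. z + axis j (e t)) has_derivative (\<lambda>h. h)) (at z)"
      by (auto intro!: derivative_eq_intros)
    from diff_chain_at[OF this holomorphic_cn_has_derivative[OF hol mem[OF z]]]
    have "((\<lambda>z. f (z + axis j (e t))) has_derivative (\<lambda>h. \<Sum>k\<in>UNIV. partial_cn k f (z + axis j (e t)) * h $ k)) (at z)"
      by (simp add: o_def)
    from has_derivative_mult_left[OF this, of "inverse (e t)"]
    show "((\<lambda>z. f (z + axis j (e t)) / e t) has_derivative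
        (\<lambda>h. \<Sum>k\<in>UNIV. partial_cn k f (z + axis j (e t)) / e t * h $ k)) (at z)"
      by (simp only: divide_inverse sum_distrib_right) (simp only: mult_ac)
  qed
  then have "(partial_cn j f has_derivative
      (\<lambda>h. \<Sum>k\<in>UNIV. integral (cbox 0 1) (\<lambda>t. partial_cn k f (z0 + axis j (e t)) / e t) * h $ k)) (at z0)"
  proof (rule has_derivative_cn_transform[OF _ open_ball z0r])
    show "integral (cbox 0 1) (\<lambda>t. f (z + axis j (e t)) / e t) = partial_cn j f z" if "z \<in> ball z0 r" for z
      using partial_cn_circle_integral[OF hol r(2)[OF that] r(1), of j] by (simp add: e_def)
  qed
  with that[of r] r(1) r(2)[OF z0r] show ?thesis by (simp add: e_def)
qed

lemma holomorphic_cn_partial_cn: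
  fixes \<Omega> :: "(complex ^ 'n) set"
  assumes "holomorphic_cn f \<Omega>" "open \<Omega>"
  shows "holomorphic_cn (partial_cn j f) \<Omega>"
  unfolding holomorphic_cn_def
proof
  fix z assume "z \<in> \<Omega>"
  then obtain a where "(partial_cn j f has_derivative (\<lambda>h. \<Sum>k\<in>UNIV. a k * h $ k)) (at z)"
    using has_derivative_partial_cn[OF assms, of z j] by metis
  then show "\<exists>a :: complex ^ 'n. (partial_cn j f has_derivative (\<lambda>h. \<Sum>j\<in>UNIV. a $ j * h $ j)) (at z)"
    by (intro exI[of _ "\<chi> k. a k"]) simp
qed

text \<open>The \<open>k\<close>-th derivative of \<open>partial_cn j f\<close> is the Cauchy
  integral of \<open>partial_cn k f\<close> over a circle in direction \<open>j\<close>. Since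
  \<open>partial_cn k f\<close> is itself holomorphic, that integral is its \<open>j\<close>-th
  derivative.\<close>

lemma partial_cn_commute:
  fixes \<Omega> :: "(complex ^ 'n) set"
  assumes "holomorphic_cn f \<Omega>" "open \<Omega>" "z \<in> \<Omega>"
  shows "partial_cn k (partial_cn j f) z = partial_cn j (partial_cn k f) z"
proof -
  obtain r where r: "r > 0" "cball z r \<subseteq> \<Omega>"
    "(partial_cn j f has_derivative (\<lambda>h. \<Sum>k\<in>UNIV. integral {0..1} (\<lambda>t. partial_cn k f (z + axis j (of_real r * exp (2 * of_real pi * \<i> * of_real t)))
       / (of_real r * exp (2 * of_real pi * \<i> * of_real t))) * h $ k)) (at z)"
    by (rule has_derivative_partial_cn[OF assms])
  show ?thesis
    unfolding partial_cn_eqI[OF r(3)]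
    by (rule partial_cn_circle_integral[OF holomorphic_cn_partial_cn[OF assms(1,2)] r(2,1), symmetric])
qed

section \<open>Closure rules, chain rule and complex Jacobians\<close>

lemma holomorphic_cn_const: "holomorphic_cn (\<lambda>z. c) \<Omega>"
  by (rule holomorphic_cnI[where a = "\<lambda>_ _. 0"]) simp

lemma has_derivative_cn_add:
  fixes f g :: "complex ^ 'n \<Rightarrow> complex"
  assumes "(f has_derivative (\<lambda>h. \<Sum>k\<in>UNIV. a k * h $ k)) F"
    and "(g has_derivative (\<lambda>h. \<Sum>k\<in>UNIV. b k * h $ k)) F"
  shows "((\<lambda>z. f z + g z) has_derivative (\<lambda>h. \<Sum>k\<in>UNIV. (a k + b k) * h $ k)) F"
  using has_derivative_add[OF assms] by (simp only: sum.distrib distrib_right)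

lemma has_derivative_cn_mult:
  fixes f g :: "complex ^ 'n \<Rightarrow> complex"
  assumes "(f has_derivative (\<lambda>h. \<Sum>k\<in>UNIV. a k * h $ k)) (at z)"
    and "(g has_derivative (\<lambda>h. \<Sum>k\<in>UNIV. b k * h $ k)) (at z)"
  shows "((\<lambda>z. f z * g z) has_derivative (\<lambda>h. \<Sum>k\<in>UNIV. (f z * b k + a k * g z) * h $ k)) (at z)"
  using has_derivative_mult[OF assms]
  by (simp only: sum.distrib distrib_right sum_distrib_left sum_distrib_right) (simp only: mult_ac)

lemma holomorphic_cn_add:
  assumes "holomorphic_cn f \<Omega>" "holomorphic_cn g \<Omega>"
  shows "holomorphic_cn (\<lambda>z. f z + g z) \<Omega>"
  by (rule holomorphic_cnI) (rule has_derivative_cn_add; rule holomorphic_cn_has_derivative, rule assms, assumption)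

lemma partial_cn_add:
  assumes "holomorphic_cn f \<Omega>" "holomorphic_cn g \<Omega>" "z \<in> \<Omega>"
  shows "partial_cn j (\<lambda>z. f z + g z) z = partial_cn j f z + partial_cn j g z"
  by (rule partial_cn_eqI[OF has_derivative_cn_add[OF holomorphic_cn_has_derivative[OF assms(1,3)] holomorphic_cn_has_derivative[OF assms(2,3)]]])

lemma holomorphic_cn_mult:
  assumes "holomorphic_cn f \<Omega>" "holomorphic_cn g \<Omega>"
  shows "holomorphic_cn (\<lambda>z. f z * g z) \<Omega>"
  by (rule holomorphic_cnI) (rule has_derivative_cn_mult; rule holomorphic_cn_has_derivative, rule assms, assumption)

lemma partial_cn_mult:
  assumes "holomorphic_cn f \<Omega>" "holomorphic_cn g \<Omega>" "z \<in> \<Omega>"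
  shows "partial_cn j (\<lambda>z. f z * g z) z = f z * partial_cn j g z + partial_cn j f z * g z"
  by (rule partial_cn_eqI[OF has_derivative_cn_mult[OF holomorphic_cn_has_derivative[OF assms(1,3)] holomorphic_cn_has_derivative[OF assms(2,3)]]])

lemma holomorphic_cn_sum:
  assumes "\<And>i. i \<in> I \<Longrightarrow> holomorphic_cn (f i) \<Omega>"
  shows "holomorphic_cn (\<lambda>z. \<Sum>i\<in>I. f i z) \<Omega>"
  using assms
  by (induction I rule: infinite_finite_induct) (auto intro: holomorphic_cn_const holomorphic_cn_add)

lemma holomorphic_cn_prod:
  assumes "\<And>i. i \<in> I \<Longrightarrow> holomorphic_cn (f i) \<Omega>"
  shows "holomorphic_cn (\<lambda>z. \<Prod>i\<in>I. f i z) \<Omega>"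
  using assms
  by (induction I rule: infinite_finite_induct) (auto intro: holomorphic_cn_const holomorphic_cn_mult)

lemma holomorphic_cn_diff:
  assumes "holomorphic_cn f \<Omega>" "holomorphic_cn g \<Omega>"
  shows "holomorphic_cn (\<lambda>z. f z - g z) \<Omega>"
  using holomorphic_cn_add[OF assms(1) holomorphic_cn_mult[OF holomorphic_cn_const[of "-1"] assms(2)]]
  by simp

lemma holomorphic_map_component: "holomorphic_map f \<Omega> \<Longrightarrow> holomorphic_cn (\<lambda>z. f z $ i) \<Omega>"
  by (simp add: holomorphic_map_def)

definition jacobian_cn :: "(complex ^ 'n \<Rightarrow> complex ^ 'n) \<Rightarrow> complex ^ 'n \<Rightarrow> complex ^ 'n ^ 'n" where
  "jacobian_cn f z = (\<chi> i j. partial_cn j (\<lambda>z. f z $ i) z)"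

lemma jacobian_det_eq: "jacobian_det f z = det (jacobian_cn f z)"
  by (simp add: jacobian_det_def jacobian_cn_def partial_cn_def)

lemma holomorphic_cn_jacobian_det:
  assumes "holomorphic_map f \<Omega>" "open \<Omega>"
  shows "holomorphic_cn (jacobian_det f) \<Omega>"
proof -
  have "holomorphic_cn (\<lambda>z. \<Sum>p\<in>{p. p permutes UNIV}. of_int (sign p) *
      (\<Prod>i\<in>UNIV. partial_cn (p i) (\<lambda>z. f z $ i) z)) \<Omega>"
    by (intro holomorphic_cn_sum holomorphic_cn_mult holomorphic_cn_const holomorphic_cn_prod
      holomorphic_cn_partial_cn[OF holomorphic_map_component[OF assms(1)] assms(2)])
  then show ?thesis
    by (simp add: jacobian_det_eq[abs_def] det_def jacobian_cn_def)
qed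

lemma holomorphic_map_has_derivative:
  assumes "holomorphic_map f \<Omega>" "z \<in> \<Omega>"
  shows "(f has_derivative (\<lambda>h. jacobian_cn f z *v h)) (at z)"
proof -
  \<comment> \<open>Writing a vector as the sum of its coordinate vectors reduces the derivative of
    the map to those of its components.\<close>
  have *: "x = (\<Sum>i\<in>UNIV. axis i (x $ i))" for x :: "complex ^ 'a"
    by (simp add: vec_eq_iff axis_def)
  have "((\<lambda>z. \<Sum>i\<in>UNIV. axis i (f z $ i)) has_derivative
      (\<lambda>h. \<Sum>i\<in>UNIV. axis i (\<Sum>k\<in>UNIV. partial_cn k (\<lambda>z. f z $ i) z * h $ k))) (at z)"
    by (intro has_derivative_sum bounded_linear.has_derivative[OF bounded_linear_axis]
      holomorphic_cn_has_derivative[OF holomorphic_map_component[OF assms(1)] assms(2)])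
  moreover have "(\<lambda>h. \<Sum>i\<in>UNIV. axis i (\<Sum>k\<in>UNIV. partial_cn k (\<lambda>z. f z $ i) z * h $ k)) = (\<lambda>h. jacobian_cn f z *v h)"
    by (rule ext, subst (2) *) (simp add: matrix_vector_mult_def jacobian_cn_def)
  ultimately show ?thesis
    by (simp flip: *)
qed

lemma has_derivative_cn_compose:
  assumes "holomorphic_cn G V" "holomorphic_map f \<Omega>" "z \<in> \<Omega>" "f z \<in> V"
  shows "((\<lambda>z. G (f z)) has_derivative
    (\<lambda>h. \<Sum>j\<in>UNIV. (\<Sum>k\<in>UNIV. partial_cn k G (f z) * partial_cn j (\<lambda>z. f z $ k) z) * h $ j)) (at z)"
proof -
  have "(\<lambda>h. \<Sum>j\<in>UNIV. (\<Sum>k\<in>UNIV. partial_cn k G (f z) * partial_cn j (\<lambda>z. f z $ k) z) * h $ j) =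
     (\<lambda>h. \<Sum>k\<in>UNIV. partial_cn k G (f z) * (jacobian_cn f z *v h) $ k)"
    by (rule ext, simp add: sum_distrib_right sum_distrib_left matrix_vector_mult_def jacobian_cn_def mult.assoc)
       (rule sum.swap)
  then show ?thesis
    using diff_chain_at[OF holomorphic_map_has_derivative[OF assms(2,3)] holomorphic_cn_has_derivative[OF assms(1,4)]]
    by (simp add: o_def)
qed

lemma holomorphic_cn_compose:
  assumes "holomorphic_cn G V" "holomorphic_map f \<Omega>" "\<And>z. z \<in> \<Omega> \<Longrightarrow> f z \<in> V"
  shows "holomorphic_cn (\<lambda>z. G (f z)) \<Omega>"
  by (rule holomorphic_cnI, rule has_derivative_cn_compose[OF assms(1,2)]) (use assms(3) in auto)

lemma partial_cn_compose:
  assumes "holomorphic_cn G V" "holomorphic_map f \<Omega>" "z \<in> \<Omega>" "f z \<in> V"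
  shows "partial_cn j (\<lambda>z. G (f z)) z = (\<Sum>k\<in>UNIV. partial_cn k G (f z) * partial_cn j (\<lambda>z. f z $ k) z)"
  by (rule partial_cn_eqI[OF has_derivative_cn_compose[OF assms]])

text \<open>By the chain rule the two Jacobian matrices multiply to the derivative of a map that is
  the identity near \<open>z\<close>.\<close>

lemma jacobian_det_inverse:
  fixes f g :: "complex ^ 'n \<Rightarrow> complex ^ 'n"
  assumes hf: "holomorphic_map f \<Omega>" and hg: "holomorphic_map g V" and op: "open \<Omega>" and z: "z \<in> \<Omega>"
    and fV: "f z \<in> V" and gf: "\<And>z. z \<in> \<Omega> \<Longrightarrow> g (f z) = z"
  shows "jacobian_det g (f z) * jacobian_det f z = 1"
proof -
  have 1: "(g \<circ> f has_derivative (\<lambda>h. jacobian_cn g (f z) *v h) \<circ> (\<lambda>h. jacobian_cn f z *v h)) (at z)"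
    by (rule diff_chain_at[OF holomorphic_map_has_derivative[OF hf z] holomorphic_map_has_derivative[OF hg fV]])
  have 2: "(g \<circ> f has_derivative (\<lambda>h. h)) (at z)"
    by (rule has_derivative_transform_within_open[OF has_derivative_ident op z]) (simp add: gf)
  have "(\<lambda>h. jacobian_cn g (f z) *v h) \<circ> (\<lambda>h. jacobian_cn f z *v h) = (\<lambda>h. h)"
    by (rule has_derivative_unique[OF 1 2])
  then have "(jacobian_cn g (f z) ** jacobian_cn f z) *v h = mat 1 *v h" for h
    by (simp add: fun_eq_iff matrix_vector_mul_assoc)
  then have "jacobian_cn g (f z) ** jacobian_cn f z = mat 1"
    by (simp add: matrix_eq)
  from arg_cong[OF this, of det] show ?thesis
    by (simp add: jacobian_det_eq det_mul)
qed

section \<open>Iterated partial derivatives along lists of indices\<close>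

lemma holomorphic_cn_foldr:
  assumes "holomorphic_cn f \<Omega>" "open \<Omega>"
  shows "holomorphic_cn (foldr partial_cn js f) \<Omega>"
  by (induction js) (use assms in \<open>auto intro: holomorphic_cn_partial_cn\<close>)

lemma foldr_partial_cn_cong:
  assumes "holomorphic_cn f \<Omega>" "open \<Omega>" "\<And>z. z \<in> \<Omega> \<Longrightarrow> f z = g z" "z \<in> \<Omega>"
  shows "foldr partial_cn js f z = foldr partial_cn js g z"
  using assms(4)
proof (induction js arbitrary: z)
  case (Cons j js)
  then show ?case
    using partial_cn_cong[OF holomorphic_cn_foldr[OF assms(1,2), of js] assms(2) Cons.IH] by simp
qed (use assms in simp)

lemma foldr_partial_cn_add:
  assumes "holomorphic_cn f \<Omega>" "holomorphic_cn g \<Omega>" "open \<Omega>" "z \<in> \<Omega>"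
  shows "foldr partial_cn js (\<lambda>z. f z + g z) z = foldr partial_cn js f z + foldr partial_cn js g z"
  using assms(4)
proof (induction js arbitrary: z)
  case (Cons j js)
  note h = holomorphic_cn_foldr[OF assms(1,3), of js] holomorphic_cn_foldr[OF assms(2,3), of js]
    holomorphic_cn_foldr[OF holomorphic_cn_add[OF assms(1,2)] assms(3), of js]
  have "partial_cn j (foldr partial_cn js (\<lambda>z. f z + g z)) z
      = partial_cn j (\<lambda>z. foldr partial_cn js f z + foldr partial_cn js g z) z"
    by (rule partial_cn_cong[OF h(3) assms(3) Cons.IH Cons.prems])
  also have "\<dots> = partial_cn j (foldr partial_cn js f) z + partial_cn j (foldr partial_cn js g) z"
    by (rule partial_cn_add[OF h(1,2) Cons.prems])
  finally show ?case by simp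
qed simp

lemma foldr_partial_cn_cmult:
  assumes "holomorphic_cn f \<Omega>" "open \<Omega>" "z \<in> \<Omega>"
  shows "foldr partial_cn js (\<lambda>z. a * f z) z = a * foldr partial_cn js f z"
  using assms(3)
proof (induction js arbitrary: z)
  case (Cons j js)
  have h: "holomorphic_cn (foldr partial_cn js f) \<Omega>" "holomorphic_cn (foldr partial_cn js (\<lambda>z. a * f z)) \<Omega>"
    by (intro holomorphic_cn_foldr holomorphic_cn_mult holomorphic_cn_const assms(1,2))+
  have "partial_cn j (foldr partial_cn js (\<lambda>z. a * f z)) z = partial_cn j (\<lambda>z. a * foldr partial_cn js f z) z"
    by (rule partial_cn_cong[OF h(2) assms(2) Cons.IH Cons.prems])
  also have "\<dots> = a * partial_cn j (foldr partial_cn js f) z"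
    using partial_cn_mult[OF holomorphic_cn_const h(1) Cons.prems, of j a]
    by (simp add: partial_cn_def[of j "\<lambda>z. a"])
  finally show ?case by simp
qed simp

lemma foldr_partial_cn_zero: "foldr partial_cn js (\<lambda>z. 0) = (\<lambda>z. 0)"
  by (induction js) (simp_all add: partial_cn_def[abs_def])

lemma foldr_partial_cn_sum:
  assumes "\<And>i. i \<in> I \<Longrightarrow> holomorphic_cn (f i) \<Omega>" "open \<Omega>" "z \<in> \<Omega>"
  shows "foldr partial_cn js (\<lambda>z. \<Sum>i\<in>I. f i z) z = (\<Sum>i\<in>I. foldr partial_cn js (f i) z)"
  using assms(1)
proof (induction I rule: infinite_finite_induct)
  case (insert i I)
  then show ?case
    using foldr_partial_cn_add[OF _ _ assms(2,3), of "f i" "\<lambda>z. \<Sum>i\<in>I. f i z" js]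
    by (simp add: holomorphic_cn_sum)
qed (simp_all add: foldr_partial_cn_zero)

text \<open>The head of the list is the outermost derivative; by commutation, the first occurrence
  of \<open>j\<close> can be moved there.\<close>

lemma foldr_partial_cn_remove1:
  assumes "holomorphic_cn f \<Omega>" "open \<Omega>" "z \<in> \<Omega>" "j \<in> set js"
  shows "foldr partial_cn js f z = partial_cn j (foldr partial_cn (remove1 j js) f) z"
  using assms(3,4)
proof (induction js arbitrary: z)
  case (Cons k js)
  show ?case
  proof (cases "k = j")
    case False
    let ?F = "foldr partial_cn (remove1 j js) f"
    have h: "holomorphic_cn ?F \<Omega>" "holomorphic_cn (foldr partial_cn js f) \<Omega>"
      using holomorphic_cn_foldr[OF assms(1,2)] by blast+
    have "partial_cn k (foldr partial_cn js f) z = partial_cn k (partial_cn j ?F) z"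
      by (rule partial_cn_cong[OF h(2) assms(2) Cons.IH Cons.prems(1)]) (use False Cons.prems in auto)
    also have "\<dots> = partial_cn j (partial_cn k ?F) z"
      by (rule partial_cn_commute[OF h(1) assms(2) Cons.prems(1)])
    finally show ?thesis using False by simp
  qed simp
qed simp

text \<open>Equal counts mean that the lists are permutations of each other. This neutralises the
  arbitrary choice of a list in \<open>multi_wirtinger_bar\<close>.\<close>

lemma foldr_partial_cn_mset:
  assumes "holomorphic_cn f \<Omega>" "open \<Omega>" "z \<in> \<Omega>" "\<And>j. count_list js j = count_list ks j"
  shows "foldr partial_cn js f z = foldr partial_cn ks f z"
  using assms(3,4)
proof (induction js arbitrary: ks z)
  case Nil
  then have "x \<notin> set ks" for x
    using count_list_0_iff[of ks x] by simp
  then have "ks = []"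
    by (cases ks) auto
  then show ?case by simp
next
  case (Cons j js)
  have j: "j \<in> set ks" using Cons.prems(2)[of j] count_list_0_iff[of ks j] by auto
  have "count_list js i = count_list (remove1 j ks) i" for i
    using Cons.prems(2)[of i] by auto
  then have "partial_cn j (foldr partial_cn js f) z = partial_cn j (foldr partial_cn (remove1 j ks) f) z"
    by (intro partial_cn_cong[OF holomorphic_cn_foldr[OF assms(1,2)] assms(2) Cons.IH Cons.prems(1)])
  then show ?case
    by (simp add: foldr_partial_cn_remove1[OF assms(1,2) Cons.prems(1) j])
qed

section \<open>From Wirtinger derivatives to complex partial derivatives\<close>

lemma wirtinger_bar_cnj:
  fixes z :: "complex ^ 'n"
  assumes hol: "holomorphic_cn G \<Omega>" and op: "open \<Omega>" and z: "z \<in> \<Omega>"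
    and eq: "\<And>w. w \<in> \<Omega> \<Longrightarrow> g w = cnj (G w)"
  shows "wirtinger_bar j g z = cnj (partial_cn j G z)"
proof -
  have G: "((\<lambda>t. G (z + axis j t)) has_field_derivative partial_cn j G z) (at 0)"
    using holomorphic_cn_axis_derivative[OF hol, of z j 0] z by (simp add: axis_def flip: zero_vec_def)
  have A: "open {t. z + axis j t \<in> \<Omega>}"
    using open_vimage[OF op, of "\<lambda>t. z + axis j t"]
    by (simp add: vimage_def continuous_on_eq_continuous_at has_derivative_continuous[OF has_derivative_axis])
  \<comment> \<open>One claim covers both real directions, \<open>a = 1\<close> and
    \<open>a = \<i>\<close>. The second gives the conjugate of \<open>\<i>\<close> times the partial
    derivative; the factor \<open>\<i>\<close> in \<open>wirtinger_bar\<close> undoes this, so both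
    terms agree and their mean is the result.\<close>
  have "((\<lambda>s. g (z + axis j (a * of_real s))) has_vector_derivative cnj (a * partial_cn j G z)) (at 0)" for a
  proof -
    have "((\<lambda>s. a * of_real s) has_vector_derivative a) (at 0 :: real filter)"
      by (auto intro!: derivative_eq_intros simp: has_vector_derivative_def scaleR_conv_of_real)
    from field_vector_diff_chain_at[OF this, of "\<lambda>t. G (z + axis j t)" "partial_cn j G z"] G
    have "((\<lambda>s. G (z + axis j (a * of_real s))) has_vector_derivative (a * partial_cn j G z)) (at 0)"
      by (simp add: o_def)
    then have 1: "((\<lambda>s. cnj (G (z + axis j (a * of_real s)))) has_vector_derivative cnj (a * partial_cn j G z)) (at 0)"
      by (rule bounded_linear.has_vector_derivative[OF bounded_linear_cnj])
    have "continuous_on UNIV (\<lambda>s :: real. a * of_real s)"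
      by (intro continuous_intros)
    then have "open ((\<lambda>s :: real. a * of_real s) -` {t. z + axis j t \<in> \<Omega>})"
      using A by (rule open_vimage[rotated])
    then show ?thesis
      by (rule has_vector_derivative_transform_within_open[OF 1])
        (use z eq in \<open>auto simp: linear_0[OF bounded_linear.linear[OF bounded_linear_axis]]\<close>)
  qed
  from this[of 1] this[of \<i>] show ?thesis
    unfolding wirtinger_bar_def by (simp add: vector_derivative_at mult.assoc[symmetric])
qed

lemma foldr_wirtinger_bar_cnj:
  assumes hol: "holomorphic_cn (\<lambda>w. cnj (g w)) \<Omega>" and op: "open \<Omega>" and z: "z \<in> \<Omega>"
  shows "foldr wirtinger_bar js g z = cnj (foldr partial_cn js (\<lambda>w. cnj (g w)) z)"
  using z
proof (induction js arbitrary: z)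
  case (Cons j js)
  show ?case
    using wirtinger_bar_cnj[OF holomorphic_cn_foldr[OF hol op] op Cons.prems Cons.IH] by simp
qed simp

text \<open>The list depends on the multi-index only. One choice therefore works for the kernels
  \<open>K z\<close> at all \<open>z\<close> simultaneously, as coefficients independent of
  \<open>z\<close> demand.\<close>

lemma multi_wirtinger_bar_cnj:
  obtains js where "\<And>g \<Omega> z. \<lbrakk>holomorphic_cn (\<lambda>w. cnj (g w)) \<Omega>; open \<Omega>; z \<in> \<Omega>\<rbrakk> \<Longrightarrow>
     multi_wirtinger_bar \<alpha> g z = cnj (foldr partial_cn js (\<lambda>w. cnj (g w)) z)"
  unfolding multi_wirtinger_bar_def using foldr_wirtinger_bar_cnj by blast

text \<open>The list \<open>js\<close> witnesses that the choice in
  \<open>multi_wirtinger_bar\<close> succeeds, and order is immaterial. Hence an iterated derivative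
  along any list is a generator of the span.\<close>

lemma multi_wirtinger_bar_count_list:
  assumes "holomorphic_cn (\<lambda>w. cnj (g w)) \<Omega>" "open \<Omega>" "z \<in> \<Omega>"
  shows "multi_wirtinger_bar (count_list js) g z = cnj (foldr partial_cn js (\<lambda>w. cnj (g w)) z)"
proof -
  have "\<forall>j. count_list (SOME ks. \<forall>j. count_list ks j = count_list js j) j = count_list js j"
    by (rule someI[of _ js]) simp
  then show ?thesis
    unfolding multi_wirtinger_bar_def foldr_wirtinger_bar_cnj[OF assms]
    using foldr_partial_cn_mset[OF assms] by metis
qed

section \<open>The real determinant of a complex matrix\<close>

lemma diagonal_matrix_mult_left:
  "((\<chi> i j. if i = j then d i else 0) ** A) $ i $ j = d i * A $ i $ j" for A :: "complex ^ 'n ^ 'n"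
  by (simp add: matrix_matrix_mult_def if_distrib[of "\<lambda>x. x * _"] cong: if_cong)

lemma diagonal_matrix_mult_right:
  "(A ** (\<chi> i j. if i = j then d i else 0)) $ i $ j = A $ i $ j * d j" for A :: "complex ^ 'n ^ 'n"
  by (simp add: matrix_matrix_mult_def if_distrib[of "\<lambda>x. _ * x"] cong: if_cong)

text \<open>An elementary matrix: multiplication from the left adds \<open>v i\<close> times row
  \<open>k\<close> to each other row \<open>i\<close>. The value \<open>v k\<close> is
  ignored.\<close>

definition column_shear :: "'n \<Rightarrow> ('n \<Rightarrow> complex) \<Rightarrow> complex ^ 'n ^ 'n" where
  "column_shear k v = (\<chi> i j. if i = j then 1 else if j = k then v i else 0)"

lemma column_shear_mult:
  "(column_shear k v ** A) $ i $ j = A $ i $ j + (if i = k then 0 else v i * A $ k $ j)"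
proof -
  have "(column_shear k v ** A) $ i $ j =
      (\<Sum>m\<in>UNIV. (if m = i then A $ m $ j else 0) + (if m = k then (if i = k then 0 else v i * A $ m $ j) else 0))"
    unfolding matrix_matrix_mult_def column_shear_def by (auto intro!: sum.cong)
  then show ?thesis by (simp add: sum.distrib)
qed

lemma column_swap_mult:
  "(A ** (\<chi> i j. if i = Transposition.transpose k l j then 1 else 0)) $ i $ j = A $ i $ Transposition.transpose k l j"
  for A :: "complex ^ 'n ^ 'n"
  by (simp add: matrix_matrix_mult_def if_distrib[of "\<lambda>x. _ * x"] cong: if_cong)

text \<open>The properties shared by the squared modulus of the complex determinant and the absolute
  real determinant. They suffice to compute the value on every elementary matrix, hence on all
  matrices.\<close>

locale multiplicative_norm =
  fixes N :: "complex ^ 'n ^ 'n \<Rightarrow> real"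
  assumes mult: "N (A ** B) = N A * N B"
    and nonneg: "N A \<ge> 0"
    and diagonal: "N (\<chi> i j. if i = j then d i else 0) = (\<Prod>i\<in>UNIV. (cmod (d i))\<^sup>2)"
begin

lemma id: "N (mat 1) = 1"
  using diagonal[of "\<lambda>_. 1"] by (simp add: mat_def)

text \<open>A shear is conjugate to its own square by a diagonal matrix.\<close>

lemma shear: "N (column_shear k v) = 1"
proof -
  let ?S = "\<chi> i j. if i = j then if i = k then 1 else 2 else 0 :: complex ^ 'n ^ 'n"
  have sq: "column_shear k v ** column_shear k w = column_shear k (\<lambda>i. v i + w i)" for v w
    by (simp add: vec_eq_iff column_shear_mult) (simp add: column_shear_def)
  have "?S ** column_shear k v = column_shear k (\<lambda>i. v i + v i) ** ?S"
    by (simp add: vec_eq_iff diagonal_matrix_mult_left diagonal_matrix_mult_right) (simp add: column_shear_def)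
  from arg_cong[OF this, of N]
  have "N ?S * N (column_shear k v) = (N (column_shear k v) * N (column_shear k v)) * N ?S"
    by (simp only: mult flip: sq)
  moreover have "N ?S \<noteq> 0"
    unfolding diagonal by simp
  \<comment> \<open>The opposite shear is the inverse, which excludes the value 0; a number equal to
    its own square is then 1.\<close>
  moreover have "N (column_shear k v) * N (column_shear k (\<lambda>i. - v i)) = 1"
    using id unfolding mult[symmetric] sq by (simp add: column_shear_def mat_def cong: if_cong)
  ultimately show ?thesis by auto
qed

text \<open>A transposition matrix is an involution, so the square of its value is 1, and the value
  is nonnegative.\<close>

lemma swap: "N (\<chi> i j. if i = Transposition.transpose k l j then 1 else 0) = 1" (is "N ?T = 1")
proof -
  have "?T ** ?T = mat 1"
    unfolding vec_eq_iff column_swap_mult by (simp add: mat_def)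
  from arg_cong[OF this, of N] have "(N ?T)\<^sup>2 = 1"
    by (simp add: mult id power2_eq_square)
  then show ?thesis using nonneg[of ?T] by (simp add: power2_eq_1_iff)
qed

text \<open>The diagonal projection that erases row \<open>k\<close> fixes \<open>A\<close> and
  itself has value 0.\<close>

lemma zero_row:
  assumes "\<And>j. A $ k $ j = 0"
  shows "N A = 0"
proof -
  have "(\<chi> i j. if i = j then if i = k then 0 else 1 else 0) ** A = A"
    unfolding vec_eq_iff diagonal_matrix_mult_left using assms by simp
  moreover have "(\<Prod>i\<in>UNIV. (cmod (if i = k then 0 else 1))\<^sup>2) = 0"
    by (rule prod_zero) auto
  ultimately show ?thesis
    by (metis (no_types) diagonal mult mult_zero_left)
qed

end

text \<open>Gaussian elimination: the induction runs over the set \<open>K\<close> of columns that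
  may still have entries off the diagonal. A shear clears column \<open>k\<close>, a column swap
  first supplies a nonzero pivot if needed, and a zero row makes both values vanish.\<close>

lemma multiplicative_norm_unique:
  assumes "multiplicative_norm N" "multiplicative_norm N'"
  shows "N A = N' A"
proof -
  interpret N: multiplicative_norm N by fact
  interpret M: multiplicative_norm N' by fact
  have "finite K \<Longrightarrow> (\<And>i j. j \<notin> K \<Longrightarrow> i \<noteq> j \<Longrightarrow> A $ i $ j = 0) \<Longrightarrow> N A = N' A" for K A
  proof (induction K arbitrary: A rule: finite_induct)
    case empty
    define d where "d i = A $ i $ i" for i
    have "A = (\<chi> i j. if i = j then d i else 0)"
      using empty by (simp add: vec_eq_iff d_def)
    then show ?case by (simp only: N.diagonal M.diagonal)
  next
    case (insert k K)
    have nonzero: "N A = N' A" if "A $ k $ k \<noteq> 0" and A: "\<And>i j. j \<notin> insert k K \<Longrightarrow> i \<noteq> j \<Longrightarrow> A $ i $ j = 0" for A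
    proof -
      let ?E = "column_shear k (\<lambda>i. - A $ i $ k / A $ k $ k)"
      \<comment> \<open>Outside \<open>insert k K\<close>, row \<open>k\<close> has only zeros, so
        the shear leaves those columns unchanged while it clears column \<open>k\<close>.\<close>
      have "N (?E ** A) = N' (?E ** A)"
      proof (rule insert.IH)
        show "(?E ** A) $ i $ j = 0" if "j \<notin> K" "i \<noteq> j" for i j
          using that \<open>A $ k $ k \<noteq> 0\<close> A[of j i] A[of j k]
          by (cases "j = k") (auto simp: column_shear_mult)
      qed
      then show ?thesis by (simp add: N.mult M.mult N.shear M.shear)
    qed
    show ?case
    proof (cases "\<exists>l. A $ k $ l \<noteq> 0")
      case True
      then obtain l where l: "A $ k $ l \<noteq> 0" by blast
      let ?T = "\<chi> i j. if i = Transposition.transpose k l j then 1 else 0 :: complex ^ 'a ^ 'a"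
      \<comment> \<open>A column \<open>l\<close> with a nonzero entry in row \<open>k\<close> is
        \<open>k\<close> itself or lies in \<open>K\<close>, so the swap does not touch the columns
        that are already cleared.\<close>
      have "N (A ** ?T) = N' (A ** ?T)"
      proof (rule nonzero)
        show "(A ** ?T) $ k $ k \<noteq> 0" using l by (simp add: column_swap_mult)
        show "(A ** ?T) $ i $ j = 0" if "j \<notin> insert k K" "i \<noteq> j" for i j
          using that l insert.prems[of l k] insert.prems[of j i]
          unfolding column_swap_mult by (auto simp: Transposition.transpose_def)
      qed
      then show ?thesis by (simp add: N.mult M.mult N.swap M.swap)
    next
      case False
      then show ?thesis using N.zero_row[of A k] M.zero_row[of A k] by simp
    qed
  qed
  from this[of UNIV] show ?thesis by simp
qed

lemma multiplicative_norm_det: "multiplicative_norm (\<lambda>A. (cmod (det A))\<^sup>2)"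
  by unfold_locales (simp_all add: det_mul norm_mult power_mult_distrib det_diagonal prod_norm flip: prod_power_distrib)

text \<open>The index type \<open>'n bit0\<close> has \<open>2 * CARD('n)\<close> elements and carries the well-order that
  \<open>has_measure_differentiable_image\<close> requires.\<close>

definition coord_index :: "'n::finite bit0 \<Rightarrow> 'n \<times> complex" where
  "coord_index = (SOME e. bij_betw e UNIV (UNIV \<times> Basis))"

lemma bij_coord_index: "bij_betw (coord_index :: 'n::finite bit0 \<Rightarrow> _) UNIV (UNIV \<times> Basis)"
proof -
  have "card (UNIV :: 'n bit0 set) = card ((UNIV :: 'n set) \<times> (Basis :: complex set))"
    by (simp add: card_cartesian_product)
  then have "\<exists>e. bij_betw e (UNIV :: 'n bit0 set) ((UNIV :: 'n set) \<times> (Basis :: complex set))"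
    by (intro finite_same_card_bij) auto
  then show ?thesis
    unfolding coord_index_def by (rule someI_ex)
qed

definition coord_basis :: "'n::finite bit0 \<Rightarrow> complex ^ 'n" where
  "coord_basis i = axis (fst (coord_index i)) (snd (coord_index i))"

lemma bij_coord_basis: "bij_betw coord_basis UNIV Basis"
proof -
  have "bij_betw (\<lambda>(j, u). axis j u) (UNIV \<times> (Basis :: complex set)) (Basis :: (complex ^ 'a) set)"
    unfolding bij_betw_def
    by (auto simp: inj_on_def axis_eq_axis nonzero_Basis Basis_vec_def)
  from bij_betw_trans[OF bij_coord_index this] show ?thesis
    by (simp add: coord_basis_def[abs_def] o_def case_prod_unfold)
qed

definition from_real_coords :: "real ^ ('n::finite bit0) \<Rightarrow> complex ^ 'n" where
  "from_real_coords x = (\<Sum>i\<in>UNIV. x $ i *\<^sub>R coord_basis i)"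

definition to_real_coords :: "complex ^ 'n \<Rightarrow> real ^ ('n::finite bit0)" where
  "to_real_coords z = (\<chi> i. z \<bullet> coord_basis i)"

lemma coord_basis_in_Basis: "coord_basis i \<in> Basis"
  using bij_coord_basis by (auto simp: bij_betw_def)

lemma inner_coord_basis: "coord_basis i \<bullet> coord_basis j = (if i = j then 1 else 0)"
  using bij_coord_basis by (auto simp: bij_betw_def inj_on_def inner_Basis coord_basis_in_Basis)

lemma to_from_real_coords [simp]: "to_real_coords (from_real_coords x) = x"
  by (simp add: vec_eq_iff to_real_coords_def from_real_coords_def inner_sum_left inner_coord_basis
      if_distrib[of "\<lambda>x. _ * x"] cong: if_cong)

lemma from_to_real_coords [simp]: "from_real_coords (to_real_coords z) = z"
proof -
  have "(\<Sum>i\<in>UNIV. (z \<bullet> coord_basis i) *\<^sub>R coord_basis i) = (\<Sum>b\<in>Basis. (z \<bullet> b) *\<^sub>R b)"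
    by (rule sum.reindex_bij_betw[OF bij_coord_basis])
  then show ?thesis
    by (simp add: to_real_coords_def from_real_coords_def euclidean_representation)
qed

lemma linear_from_real_coords: "linear from_real_coords"
  by (rule linearI) (simp_all add: from_real_coords_def sum.distrib scaleR_add_left scaleR_sum_right)

lemma linear_to_real_coords: "linear to_real_coords"
  by (rule linearI) (simp_all add: to_real_coords_def vec_eq_iff inner_add_left)

lemma norm_from_real_coords: "norm (from_real_coords x) = norm x"
  by (simp add: norm_eq_sqrt_inner from_real_coords_def inner_sum_left inner_sum_right inner_coord_basis
      inner_vec_def[of x x] if_distrib[of "\<lambda>x. _ * x"] cong: if_cong)

lemma norm_to_real_coords: "norm (to_real_coords z) = norm z"
  using norm_from_real_coords[of "to_real_coords z"] by simp

text \<open>The coordinate map only relabels an orthonormal basis: preimages of boxes are boxes with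
  the same side lengths, and Lebesgue measure is determined by its values on boxes.\<close>

lemma distr_from_real_coords: "distr lborel lborel from_real_coords = (lborel :: (complex ^ 'n) measure)"
proof (rule lborel_eqI[symmetric])
  have meas: "from_real_coords \<in> borel_measurable borel"
    by (intro borel_measurable_continuous_onI linear_continuous_on linear_conv_bounded_linear[THEN iffD1] linear_from_real_coords)
  fix l u :: "complex ^ 'n"
  assume lu: "\<And>b. b \<in> Basis \<Longrightarrow> l \<bullet> b \<le> u \<bullet> b"
  have basis: "(\<forall>b\<in>Basis. P b) \<longleftrightarrow> (\<forall>i. P (coord_basis i))" for P :: "complex ^ 'n \<Rightarrow> bool"
    using bij_coord_basis by (metis UNIV_I bij_betw_iff_bijections)
  have inner: "from_real_coords x \<bullet> coord_basis i = x $ i" for x :: "real ^ 'n bit0" and i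
    using to_from_real_coords[of x] by (metis to_real_coords_def vec_lambda_beta)
  have pre: "from_real_coords -` box l u = box (to_real_coords l) (to_real_coords u)"
    unfolding set_eq_iff vimage_eq mem_box_cart by (simp add: mem_box basis inner to_real_coords_def)
  have "emeasure (distr lborel lborel from_real_coords) (box l u) = emeasure lborel (box (to_real_coords l) (to_real_coords u))"
    using meas by (subst emeasure_distr) (simp_all add: pre)
  also have "\<dots> = (\<Prod>b\<in>Basis. (to_real_coords u - to_real_coords l) \<bullet> b)"
    using lu[OF coord_basis_in_Basis] by (subst emeasure_lborel_box) (auto simp: Basis_vec_def inner_axis to_real_coords_def)
  also have "\<dots> = (\<Prod>i\<in>UNIV. (u - l) \<bullet> coord_basis i)"
    by (subst prod.reindex_bij_betw[of "\<lambda>i. axis i 1" UNIV Basis, symmetric])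
       (auto simp: bij_betw_def inj_on_def axis_eq_axis Basis_vec_def inner_axis to_real_coords_def inner_diff_left)
  also have "\<dots> = (\<Prod>b\<in>Basis. (u - l) \<bullet> b)"
    by (subst prod.reindex_bij_betw[OF bij_coord_basis]) simp
  finally show "emeasure (distr lborel lborel from_real_coords) (box l u) = (\<Prod>b\<in>Basis. (u - l) \<bullet> b)" .
qed simp

section \<open>Real determinants of complex linear maps\<close>

definition real_det :: "(complex ^ 'n \<Rightarrow> complex ^ 'n) \<Rightarrow> real" where
  "real_det L = det (matrix (to_real_coords \<circ> L \<circ> from_real_coords))"

lemma linear_matrix_vector_mult_complex: "linear (\<lambda>h. A *v h)" for A :: "complex ^ 'n ^ 'n"
  by (rule linearI) (simp_all add: matrix_vector_mult_def vec_eq_iff scaleR_sum_right distrib_left sum.distrib)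

lemma real_det_compose:
  assumes "linear L" "linear M"
  shows "real_det (L \<circ> M) = real_det L * real_det M"
proof -
  have "linear (to_real_coords \<circ> L \<circ> from_real_coords)" "linear (to_real_coords \<circ> M \<circ> from_real_coords)"
    using assms by (auto intro!: linear_compose linear_to_real_coords linear_from_real_coords)
  from matrix_compose[OF this(2,1)]
  have "matrix (to_real_coords \<circ> (L \<circ> M) \<circ> from_real_coords) =
      matrix (to_real_coords \<circ> L \<circ> from_real_coords) ** matrix (to_real_coords \<circ> M \<circ> from_real_coords)"
    by (simp add: o_def)
  then show ?thesis by (simp add: real_det_def det_mul)
qed

lemma real_det_isometry:
  assumes "linear L" "\<And>h. norm (L h) = norm h"
  shows "\<bar>real_det L\<bar> = 1"
proof -
  have "orthogonal_transformation (to_real_coords \<circ> L \<circ> from_real_coords)"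
    unfolding orthogonal_transformation
    using assms by (auto intro!: linear_compose linear_to_real_coords linear_from_real_coords
      simp: norm_from_real_coords norm_to_real_coords)
  then show ?thesis
    unfolding real_det_def by (rule orthogonal_transformation_det)
qed

lemma diagonal_matrix_vector:
  "(\<chi> i j. if i = j then d i else 0) *v h = (\<chi> i. d i * h $ i)" for d :: "'n::finite \<Rightarrow> complex"
  by (simp add: vec_eq_iff matrix_vector_mult_def if_distrib[of "\<lambda>x. x * _"] cong: if_cong)

lemma real_det_real_diagonal:
  fixes a :: "'n::finite \<Rightarrow> real"
  shows "real_det (\<lambda>h. \<chi> i. complex_of_real (a i) * h $ i) = (\<Prod>i\<in>UNIV. (a i)\<^sup>2)"
proof -
  let ?L = "\<lambda>h :: complex ^ 'n. \<chi> i. complex_of_real (a i) * h $ i"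
  have scale: "?L (coord_basis k) = a (fst (coord_index k)) *\<^sub>R coord_basis k" for k
    by (simp add: vec_eq_iff coord_basis_def axis_def scaleR_conv_of_real[where 'a = complex])
  have fb: "from_real_coords (axis k 1) = coord_basis k" for k :: "'n bit0"
    by (simp add: from_real_coords_def axis_def if_distrib[of "\<lambda>x. x *\<^sub>R _"] cong: if_cong)
  have "matrix (to_real_coords \<circ> ?L \<circ> from_real_coords) $ i $ k = (if i = k then a (fst (coord_index k)) else 0)" for i k
    by (simp add: matrix_def fb scale) (auto simp: to_real_coords_def inner_coord_basis)
  then have "real_det ?L = (\<Prod>k\<in>UNIV. a (fst (coord_index (k :: 'n bit0))))"
    by (simp add: real_det_def det_diagonal)
  also have "\<dots> = (\<Prod>p\<in>UNIV \<times> (Basis :: complex set). a (fst p))"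
    by (rule prod.reindex_bij_betw[OF bij_coord_index])
  \<comment> \<open>Each \<open>a i\<close> occurs twice, once for the real and once for the
    imaginary direction; hence the square.\<close>
  also have "\<dots> = (\<Prod>i\<in>UNIV. \<Prod>u\<in>(Basis :: complex set). a i)"
    by (subst prod.cartesian_product) (simp add: case_prod_unfold)
  finally show ?thesis by simp
qed

text \<open>Polar form of the diagonal entries: the unimodular factors give an isometry, of absolute
  determinant 1, and the moduli give a real diagonal map.\<close>

lemma multiplicative_norm_real_det: "multiplicative_norm (\<lambda>A. \<bar>real_det (\<lambda>h. A *v h)\<bar>)"
proof
  fix A B :: "complex ^ 'n ^ 'n" and d :: "'n \<Rightarrow> complex"
  show mult: "\<bar>real_det (\<lambda>h. (A ** B) *v h)\<bar> = \<bar>real_det (\<lambda>h. A *v h)\<bar> * \<bar>real_det (\<lambda>h. B *v h)\<bar>" for A B :: "complex ^ 'n ^ 'n"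
    using real_det_compose[OF linear_matrix_vector_mult_complex[of A] linear_matrix_vector_mult_complex[of B]]
    by (simp add: o_def matrix_vector_mul_assoc abs_mult)
  \<comment> \<open>\<open>sgn 0\<close> is 0, so the value 1 is substituted there to keep every
    \<open>u i\<close> unimodular.\<close>
  define u where "u i = (if d i = 0 then 1 else sgn (d i))" for i
  have u: "cmod (u i) = 1" "d i = of_real (cmod (d i)) * u i" for i
    by (simp add: u_def norm_sgn, simp add: u_def sgn_eq)
  have "(\<chi> i j. if i = j then d i else 0) = (\<chi> i j. if i = j then of_real (cmod (d i)) else 0) ** (\<chi> i j. if i = j then u i else 0)"
    unfolding vec_eq_iff diagonal_matrix_mult_left using u(2) by simp
  moreover have "\<bar>real_det (\<lambda>h. (\<chi> i j. if i = j then u i else 0) *v h)\<bar> = 1"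
  proof (rule real_det_isometry[OF linear_matrix_vector_mult_complex])
    show "norm ((\<chi> i j. if i = j then u i else 0) *v h) = norm h" for h
      by (simp add: diagonal_matrix_vector norm_vec_def norm_mult u(1) cong: L2_set_cong)
  qed
  ultimately show "\<bar>real_det (\<lambda>h. (\<chi> i j. if i = j then d i else 0) *v h)\<bar> = (\<Prod>i\<in>UNIV. (cmod (d i))\<^sup>2)"
    by (simp add: mult diagonal_matrix_vector real_det_real_diagonal abs_prod)
qed simp

lemma abs_real_det: "\<bar>real_det (\<lambda>h. A *v h)\<bar> = (cmod (det A))\<^sup>2"
  by (rule multiplicative_norm_unique[OF multiplicative_norm_real_det multiplicative_norm_det])

section \<open>Change of variables under a biholomorphism\<close>

text \<open>The real change of variables formula, carried to complex space by the measure-preserving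
  coordinates; \<open>abs_real_det\<close> identifies the weight.\<close>

lemma emeasure_holomorphic_image:
  fixes f :: "complex ^ 'n \<Rightarrow> complex ^ 'n"
  assumes hol: "holomorphic_map f \<Omega>" and op: "open \<Omega>" and S: "S \<subseteq> \<Omega>" "S \<in> sets borel"
    and inj: "inj_on f S" and fS: "f ` S \<in> sets borel" "emeasure lborel (f ` S) < \<infinity>"
  shows "emeasure lborel (f ` S) = (\<integral>\<^sup>+z. ennreal ((cmod (jacobian_det f z))\<^sup>2) * indicator S z \<partial>lborel)"
proof -
  let ?P = "from_real_coords :: real ^ 'n bit0 \<Rightarrow> complex ^ 'n"
  let ?F = "to_real_coords \<circ> f \<circ> ?P"
  let ?F' = "\<lambda>x. to_real_coords \<circ> (\<lambda>h. jacobian_cn f (?P x) *v h) \<circ> ?P"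
  let ?J = "\<lambda>z. (cmod (jacobian_det f z))\<^sup>2"
  have measP [measurable]: "?P \<in> borel_measurable borel"
    by (intro borel_measurable_continuous_onI linear_continuous_on linear_conv_bounded_linear[THEN iffD1] linear_from_real_coords)
  have vol: "emeasure lborel (?P -` A) = emeasure lborel A" if "A \<in> sets borel" for A
    using emeasure_distr[of ?P lborel lborel A] that by (simp add: distr_from_real_coords)
  have pre: "?P -` A \<in> sets borel" if "A \<in> sets borel" for A
    using measurable_sets[OF measP that] by simp
  have img: "?F ` (?P -` S) = ?P -` (f ` S)"
  proof (intro equalityI subsetI)
    fix x assume "x \<in> ?P -` (f ` S)"
    then obtain z where z: "z \<in> S" "?P x = f z" by auto
    then have "x = ?F (to_real_coords z)" by (simp flip: z(2))
    then show "x \<in> ?F ` (?P -` S)" using z(1) by (intro image_eqI[of _ _ "to_real_coords z"]) auto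
  qed auto
  have der: "(?F has_derivative ?F' x) (at x within ?P -` S)" if "x \<in> ?P -` S" for x
  proof -
    have "?P x \<in> \<Omega>" using that S(1) by auto
    note f = holomorphic_map_has_derivative[OF hol this]
    show ?thesis
      by (rule has_derivative_at_withinI[OF diff_chain_at[OF linear_imp_has_derivative[OF linear_from_real_coords]
        diff_chain_at[OF f linear_imp_has_derivative[OF linear_to_real_coords]]]])
  qed
  have injF: "inj_on ?F (?P -` S)"
  proof (rule inj_onI)
    fix x y assume xy: "x \<in> ?P -` S" "y \<in> ?P -` S" "?F x = ?F y"
    then have "f (?P x) = f (?P y)" by (metis comp_apply from_to_real_coords)
    then have "?P x = ?P y" using xy inj by (auto dest: inj_onD)
    then show "x = y" by (metis to_from_real_coords)
  qed
  have "?F ` (?P -` S) \<in> lmeasurable"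
    unfolding img by (rule fmeasurableI) (use fS in \<open>simp_all add: pre vol\<close>)
  then have "((\<lambda>x. \<bar>det (matrix (?F' x))\<bar>) has_integral measure lebesgue (?F ` (?P -` S))) (?P -` S)"
    using has_measure_differentiable_image[OF _ der injF] sets_completionI_sets[of "?P -` S" lborel] pre[OF S(2)]
    by auto
  then have "((\<lambda>x. ?J (?P x)) has_integral measure lebesgue (?F ` (?P -` S))) (?P -` S)"
    using abs_real_det[of "jacobian_cn f (?P _)"] by (simp add: real_det_def jacobian_det_eq)
  then have "(\<integral>\<^sup>+x. ennreal (?J (?P x)) * indicator (?P -` S) x \<partial>lborel) = measure lebesgue (?F ` (?P -` S))"
    by (rule nn_integral_has_integral_lebesgue'[rotated]) simp
  also have "\<dots> = emeasure lborel (f ` S)"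
    unfolding img using fS by (simp add: measure_completion pre vol emeasure_eq_ennreal_measure[symmetric])
  also have "(\<integral>\<^sup>+x. ennreal (?J (?P x)) * indicator (?P -` S) x \<partial>lborel)
      = (\<integral>\<^sup>+z. ennreal (?J z) * indicator S z \<partial>distr lborel lborel ?P)"
  proof -
    have "(\<lambda>z. indicator S z *\<^sub>R ?J z) \<in> borel_measurable borel"
      by (rule borel_measurable_continuous_on_indicator[OF S(2)])
         (auto intro!: continuous_intros continuous_on_subset[OF holomorphic_cn_continuous_on[OF holomorphic_cn_jacobian_det[OF hol op]] S(1)])
    then have "(\<lambda>z. ennreal (indicator S z *\<^sub>R ?J z)) \<in> borel_measurable borel"
      by simp
    moreover have "(\<lambda>z. ennreal (indicator S z *\<^sub>R ?J z)) = (\<lambda>z. ennreal (?J z) * indicator S z)"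
      by (auto simp: indicator_def)
    ultimately have "(\<lambda>z. ennreal (?J z) * indicator S z) \<in> borel_measurable (distr lborel lborel ?P)"
      by (simp only: measurable_lborel2 distr_from_real_coords)
    from nn_integral_distr[OF _ this] show ?thesis
      by (simp add: indicator_def vimage_def)
  qed
  finally show ?thesis by (simp add: distr_from_real_coords)
qed

text \<open>The inverse \<open>g\<close> is a parameter of its own, so that the assumptions are
  symmetric and each result also holds with the roles exchanged. Inverting \<open>inv_into\<close>
  once more would recover \<open>f\<close> only on the domain.\<close>

locale biholomorphic_pair =
  fixes \<Omega> V :: "(complex ^ 'n) set" and f g :: "complex ^ 'n \<Rightarrow> complex ^ 'n"
  assumes open_dom: "open \<Omega>" and open_img: "open V"
    and finite_dom: "emeasure lborel \<Omega> < \<infinity>" and finite_img: "emeasure lborel V < \<infinity>"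
    and hol_f: "holomorphic_map f \<Omega>" and hol_g: "holomorphic_map g V"
    and f_in: "z \<in> \<Omega> \<Longrightarrow> f z \<in> V" and g_in: "w \<in> V \<Longrightarrow> g w \<in> \<Omega>"
    and gf: "z \<in> \<Omega> \<Longrightarrow> g (f z) = z" and fg: "w \<in> V \<Longrightarrow> f (g w) = w"
begin

lemma inverse_pair: "biholomorphic_pair V \<Omega> g f"
  by unfold_locales (use open_dom open_img finite_dom finite_img hol_f hol_g f_in g_in gf fg in auto)

abbreviation "u \<equiv> jacobian_det f"

abbreviation "u' \<equiv> jacobian_det g"

lemma hol_u: "holomorphic_cn u \<Omega>"
  by (rule holomorphic_cn_jacobian_det[OF hol_f open_dom])

lemma u'_u: "z \<in> \<Omega> \<Longrightarrow> u' (f z) * u z = 1"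
  by (rule jacobian_det_inverse[OF hol_f hol_g open_dom _ f_in gf])

lemma u_u': "w \<in> V \<Longrightarrow> u (g w) * u' w = 1"
  by (rule jacobian_det_inverse[OF hol_g hol_f open_img _ g_in fg])

lemma continuous_on_f: "continuous_on \<Omega> f"
  by (meson continuous_at_imp_continuous_on has_derivative_continuous holomorphic_map_has_derivative hol_f)

lemma measurable_f: "(\<lambda>z. indicator \<Omega> z *\<^sub>R f z) \<in> borel_measurable borel"
  by (rule borel_measurable_continuous_on_indicator) (use open_dom continuous_on_f in auto)

lemma measurable_weight: "(\<lambda>z. indicator \<Omega> z * (cmod (u z))\<^sup>2) \<in> borel_measurable borel"
  using borel_measurable_continuous_on_indicator[of \<Omega> "\<lambda>z. (cmod (u z))\<^sup>2"] open_dom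
    continuous_on_power[OF continuous_on_norm[OF holomorphic_cn_continuous_on[OF hol_u]]]
  by simp

text \<open>Change of variables stated as equality of measures, so that it transfers to integrals of
  functions with values in any suitable Banach space. The indicators make the map and weight Borel
  on the whole space; off the domain the map is 0, but so is the weight.\<close>

lemma distr_weighted_lborel:
  "distr (density lborel (\<lambda>z. ennreal (indicator \<Omega> z * (cmod (u z))\<^sup>2))) lborel (\<lambda>z. indicator \<Omega> z *\<^sub>R f z)
    = density lborel (\<lambda>w. ennreal (indicator V w))" (is "distr (density lborel ?w) lborel ?f = ?R")
proof (rule measure_eqI)
  fix A assume "A \<in> sets (distr (density lborel ?w) lborel ?f)"
  then have A: "A \<in> sets borel" by simp
  note [measurable] = measurable_f measurable_weight A
  have V: "V \<in> sets borel" and \<Omega>: "\<Omega> \<in> sets borel" using open_img open_dom by auto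
  define S where "S = \<Omega> \<inter> ?f -` A"
  have S: "S \<in> sets borel" "S \<subseteq> \<Omega>"
    unfolding S_def using measurable_sets[OF measurable_f A] \<Omega> by auto
  have img: "f ` S = A \<inter> V"
  proof (intro equalityI subsetI)
    fix w assume "w \<in> A \<inter> V"
    then show "w \<in> f ` S"
      using g_in fg by (intro image_eqI[of _ _ "g w"]) (auto simp: S_def)
  qed (auto simp: S_def f_in)
  \<comment> \<open>The finite volume of \<open>V\<close> provides the finiteness that
    \<open>emeasure_holomorphic_image\<close> demands.\<close>
  have "emeasure lborel (f ` S) \<le> emeasure lborel V"
    by (rule emeasure_mono) (use V img in auto)
  then have fin: "emeasure lborel (f ` S) < \<infinity>"
    using finite_img by (rule le_less_trans)
  have "emeasure (distr (density lborel ?w) lborel ?f) A = (\<integral>\<^sup>+z. ?w z * indicator (?f -` A) z \<partial>lborel)"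
    using measurable_sets[OF measurable_f A] by (simp add: emeasure_distr emeasure_density)
  also have "\<dots> = (\<integral>\<^sup>+z. ennreal ((cmod (u z))\<^sup>2) * indicator S z \<partial>lborel)"
    by (rule nn_integral_cong) (auto simp: S_def indicator_def)
  also have "\<dots> = emeasure lborel (f ` S)"
    by (rule emeasure_holomorphic_image[OF hol_f open_dom S(2,1) _ _ fin, symmetric])
       (use A V img gf S in \<open>auto intro: inj_on_inverseI\<close>)
  also have "\<dots> = (\<integral>\<^sup>+w. indicator (A \<inter> V) w \<partial>lborel)"
    using A V by (simp add: img)
  also have "\<dots> = (\<integral>\<^sup>+w. ennreal (indicator V w) * indicator A w \<partial>lborel)"
    by (rule nn_integral_cong) (auto simp: indicator_def)
  also have "\<dots> = emeasure ?R A"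
    using A V by (simp add: emeasure_density)
  finally show "emeasure (distr (density lborel ?w) lborel ?f) A = emeasure ?R A" .
qed simp

text \<open>The value type stays general for two uses: squared moduli, which are real, and pairings
  with the kernel, which are complex.\<close>

lemma change_of_variables:
  fixes H :: "complex ^ 'n \<Rightarrow> 'b :: {banach, second_countable_topology}"
  assumes H: "set_integrable lborel V H"
  shows "set_integrable lborel \<Omega> (\<lambda>z. (cmod (u z))\<^sup>2 *\<^sub>R H (f z))"
    and "(LINT w:V|lborel. H w) = (LINT z:\<Omega>|lborel. (cmod (u z))\<^sup>2 *\<^sub>R H (f z))"
proof -
  let ?H = "\<lambda>w. indicator V w *\<^sub>R H w"
  let ?f = "\<lambda>z. indicator \<Omega> z *\<^sub>R f z"
  let ?w = "\<lambda>z. indicator \<Omega> z * (cmod (u z))\<^sup>2"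
  have int: "integrable lborel ?H" using H by (simp add: set_integrable_def)
  then have m: "?H \<in> borel_measurable lborel" by (rule borel_measurable_integrable)
  have V: "V \<in> sets borel" using open_img by auto
  have ind: "(\<lambda>w. indicator V w :: real) \<in> borel_measurable lborel" using V by simp
  have comp: "(\<lambda>z. ?H (?f z)) \<in> borel_measurable lborel"
    using measurable_compose[OF measurable_f, of ?H borel] m by simp
  have eqV: "indicator V w *\<^sub>R ?H w = ?H w" for w by (simp add: indicator_def)
  have eq\<Omega>: "?w z *\<^sub>R ?H (?f z) = indicator \<Omega> z *\<^sub>R ((cmod (u z))\<^sup>2 *\<^sub>R H (f z))" for z
    using f_in by (auto simp: indicator_def)
  have meas: "?w \<in> borel_measurable lborel" "?f \<in> measurable (density lborel ?w) lborel"
    using measurable_weight measurable_f by simp_all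
  have "integrable (density lborel (\<lambda>w. ennreal (indicator V w))) ?H"
    using integrable_density[OF m ind] int by (simp only: eqV) simp
  then have "integrable (density lborel ?w) (\<lambda>z. ?H (?f z))"
    unfolding distr_weighted_lborel[symmetric] by (rule integrable_distr_eq[OF meas(2) m, THEN iffD1])
  then show "set_integrable lborel \<Omega> (\<lambda>z. (cmod (u z))\<^sup>2 *\<^sub>R H (f z))"
    using integrable_density[OF comp meas(1)] by (simp only: eq\<Omega> set_integrable_def) simp
  have "(LINT w:V|lborel. H w) = integral\<^sup>L (density lborel (\<lambda>w. ennreal (indicator V w))) ?H"
    using integral_density[OF m ind] by (simp only: eqV set_lebesgue_integral_def) simp
  also have "\<dots> = integral\<^sup>L (density lborel ?w) (\<lambda>z. ?H (?f z))"
    unfolding distr_weighted_lborel[symmetric] by (rule integral_distr[OF meas(2) m])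
  also have "\<dots> = (LINT z:\<Omega>|lborel. (cmod (u z))\<^sup>2 *\<^sub>R H (f z))"
    using integral_density[OF comp meas(1)] by (simp only: eq\<Omega> set_lebesgue_integral_def) simp
  finally show "(LINT w:V|lborel. H w) = (LINT z:\<Omega>|lborel. (cmod (u z))\<^sup>2 *\<^sub>R H (f z))" .
qed

end

section \<open>Bergman kernels and Bergman spans\<close>

lemma bergman_space_borel:
  assumes "F \<in> bergman_space \<Omega>" "open \<Omega>"
  shows "(\<lambda>z. indicator \<Omega> z *\<^sub>R F z) \<in> borel_measurable lborel"
  using assms borel_measurable_continuous_on_indicator[of \<Omega> F]
  by (simp add: bergman_space_def holomorphic_cn_continuous_on)

lemma bergman_mult_integrable:
  assumes F: "F \<in> bergman_space \<Omega>" and G: "G \<in> bergman_space \<Omega>" and op: "open \<Omega>"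
  shows "set_integrable lborel \<Omega> (\<lambda>z. F z * cnj (G z))"
  unfolding set_integrable_def
proof (rule Bochner_Integration.integrable_bound)
  have "set_integrable lborel \<Omega> (\<lambda>z. (cmod (F z))\<^sup>2 + (cmod (G z))\<^sup>2)"
    using F G by (intro set_integral_add) (auto simp: bergman_space_def)
  then show "integrable lborel (\<lambda>z. indicator \<Omega> z *\<^sub>R ((cmod (F z))\<^sup>2 + (cmod (G z))\<^sup>2))"
    by (simp add: set_integrable_def)
  have "(\<lambda>z. (indicator \<Omega> z *\<^sub>R F z) * cnj (indicator \<Omega> z *\<^sub>R G z)) \<in> borel_measurable lborel"
    using bergman_space_borel[OF F op] bergman_space_borel[OF G op]
    by (intro borel_measurable_times measurable_compose[of _ lborel borel cnj])
      (auto intro!: borel_measurable_continuous_onI continuous_intros)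
  moreover have "(\<lambda>z. (indicator \<Omega> z *\<^sub>R F z) * cnj (indicator \<Omega> z *\<^sub>R G z)) = (\<lambda>z. indicator \<Omega> z *\<^sub>R (F z * cnj (G z)))"
    by (auto simp: indicator_def)
  ultimately show "(\<lambda>z. indicator \<Omega> z *\<^sub>R (F z * cnj (G z))) \<in> borel_measurable lborel"
    by simp
  have "cmod (F z) * cmod (G z) \<le> (cmod (F z))\<^sup>2 + (cmod (G z))\<^sup>2" for z
    using sum_squares_bound[of "cmod (F z)" "cmod (G z)"] mult_nonneg_nonneg[OF norm_ge_zero[of "F z"] norm_ge_zero[of "G z"]]
    by linarith
  then show "AE z in lborel. norm (indicator \<Omega> z *\<^sub>R (F z * cnj (G z))) \<le>
      norm (indicator \<Omega> z *\<^sub>R ((cmod (F z))\<^sup>2 + (cmod (G z))\<^sup>2))"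
    by (auto simp: indicator_def norm_mult)
qed

lemma bergman_scale:
  assumes "F \<in> bergman_space \<Omega>"
  shows "(\<lambda>z. c * F z) \<in> bergman_space \<Omega>"
  using assms holomorphic_cn_mult[OF holomorphic_cn_const, of F \<Omega> c]
  by (auto simp: bergman_space_def norm_mult power_mult_distrib)

lemma bergman_diff:
  assumes F: "F \<in> bergman_space \<Omega>" and G: "G \<in> bergman_space \<Omega>" and op: "open \<Omega>"
  shows "(\<lambda>z. F z - G z) \<in> bergman_space \<Omega>"
proof -
  have "set_integrable lborel \<Omega> (\<lambda>z. F z * cnj (F z) + G z * cnj (G z) - F z * cnj (G z) - G z * cnj (F z))"
    by (intro set_integral_add set_integral_diff bergman_mult_integrable F G op)
  then have "set_integrable lborel \<Omega> (\<lambda>z. complex_of_real ((cmod (F z - G z))\<^sup>2))"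
    unfolding complex_norm_square by (simp add: algebra_simps)
  from integrable_Re[OF this[unfolded set_integrable_def]]
  have "set_integrable lborel \<Omega> (\<lambda>z. (cmod (F z - G z))\<^sup>2)"
    unfolding set_integrable_def by simp
  then show ?thesis
    using holomorphic_cn_diff[of F \<Omega> G] F G by (simp add: bergman_space_def)
qed

text \<open>The set where \<open>F\<close> does not vanish is null by the integral and open by
  continuity, and a nonempty open set is not negligible.\<close>

lemma bergman_zero_norm:
  assumes F: "F \<in> bergman_space \<Omega>" and op: "open \<Omega>"
    and zero: "(LINT z:\<Omega>|lborel. F z * cnj (F z)) = 0" and w: "w \<in> \<Omega>"
  shows "F w = 0"
proof (rule ccontr)
  assume "F w \<noteq> 0"
  have int: "integrable lborel (\<lambda>z. indicator \<Omega> z *\<^sub>R (cmod (F z))\<^sup>2)"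
    using F by (simp add: bergman_space_def set_integrable_def)
  have "complex_of_real (integral\<^sup>L lborel (\<lambda>z. indicator \<Omega> z *\<^sub>R (cmod (F z))\<^sup>2)) = (LINT z:\<Omega>|lborel. F z * cnj (F z))"
    unfolding set_lebesgue_integral_def integral_complex_of_real[symmetric]
    by (intro Bochner_Integration.integral_cong refl) (simp add: indicator_def complex_norm_square[symmetric])
  then have "AE z in lborel. indicator \<Omega> z *\<^sub>R (cmod (F z))\<^sup>2 = 0"
    using integral_nonneg_eq_0_iff_AE[OF int] zero by (simp add: indicator_def)
  moreover define S where "S = \<Omega> \<inter> F -` (- {0})"
  have "open S"
    unfolding S_def
    by (rule continuous_open_preimage[OF holomorphic_cn_continuous_on op]) (use F in \<open>auto simp: bergman_space_def\<close>)
  ultimately have "S \<in> null_sets lborel"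
    by (intro AE_iff_null_sets[THEN iffD2]) (auto simp: S_def indicator_def elim!: eventually_mono)
  then have "negligible S"
    unfolding negligible_iff_null_sets by (rule null_sets_completionI)
  then show False
    using open_not_negligible[OF \<open>open S\<close>] w \<open>F w \<noteq> 0\<close> by (auto simp: S_def)
qed

lemma bergman_kernel_cnj:
  assumes "is_bergman_kernel \<Omega> K" "z \<in> \<Omega>"
  shows "(\<lambda>w. cnj (K z w)) \<in> bergman_space \<Omega>" "holomorphic_cn (\<lambda>w. cnj (K z w)) \<Omega>"
  using assms by (auto simp: is_bergman_kernel_def bergman_space_def)

text \<open>The conjugated difference \<open>G\<close> of the kernels lies in the space, and both
  kernels reproduce \<open>G z\<close>. Its squared norm is the difference of these two values,
  hence 0.\<close>

lemma bergman_kernel_unique: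
  assumes K: "is_bergman_kernel \<Omega> K" and L: "is_bergman_kernel \<Omega> L" and op: "open \<Omega>"
    and z: "z \<in> \<Omega>" and w: "w \<in> \<Omega>"
  shows "K z w = L z w"
proof -
  define G where "G w = cnj (K z w) - cnj (L z w)" for w
  have G: "G \<in> bergman_space \<Omega>"
    unfolding G_def by (rule bergman_diff[OF bergman_kernel_cnj(1)[OF K z] bergman_kernel_cnj(1)[OF L z] op])
  have int: "set_integrable lborel \<Omega> (\<lambda>w. G w * M z w)" if "is_bergman_kernel \<Omega> M" for M
    using bergman_mult_integrable[OF G bergman_kernel_cnj(1)[OF that z] op] by simp
  have "(LINT w:\<Omega>|lborel. G w * cnj (G w)) = (LINT w:\<Omega>|lborel. G w * K z w - G w * L z w)"
    by (simp add: G_def algebra_simps)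
  also have "\<dots> = (LINT w:\<Omega>|lborel. G w * K z w) - (LINT w:\<Omega>|lborel. G w * L z w)"
    by (rule set_integral_diff(2)[OF int[OF K] int[OF L]])
  also have "\<dots> = 0"
    using K L G z by (simp add: is_bergman_kernel_def)
  finally have "G w = 0"
    by (rule bergman_zero_norm[OF G op _ w])
  then show ?thesis by (simp add: G_def flip: complex_cnj_diff)
qed

text \<open>The representative \<open>K\<close> is fixed here. In \<open>bergman_span\<close> two
  elements may come with different ones, which would obstruct taking sums.\<close>

definition in_kernel_span ::
  "(complex ^ 'n) set \<Rightarrow> (complex ^ 'n \<Rightarrow> complex ^ 'n \<Rightarrow> complex) \<Rightarrow> (complex ^ 'n \<Rightarrow> complex) \<Rightarrow> bool" where
  "in_kernel_span \<Omega> K h \<longleftrightarrow> (\<exists>S c. finite S \<and> S \<subseteq> UNIV \<times> \<Omega> \<and>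
     (\<forall>z\<in>\<Omega>. h z = (\<Sum>(\<alpha>, w)\<in>S. c \<alpha> w * multi_wirtinger_bar \<alpha> (K z) w)))"

lemma bergman_span_iff: "h \<in> bergman_span \<Omega> \<longleftrightarrow> (\<exists>K. is_bergman_kernel \<Omega> K \<and> in_kernel_span \<Omega> K h)"
  by (simp add: bergman_span_def in_kernel_span_def)

lemma in_kernel_spanE:
  assumes "in_kernel_span \<Omega> K h"
  obtains S c where "finite S" "S \<subseteq> UNIV \<times> \<Omega>"
    "\<And>z. z \<in> \<Omega> \<Longrightarrow> h z = (\<Sum>(\<alpha>, w)\<in>S. c \<alpha> w * multi_wirtinger_bar \<alpha> (K z) w)"
  using assms unfolding in_kernel_span_def by blast

lemma in_kernel_span_cong:
  assumes "in_kernel_span \<Omega> K h" "\<And>z. z \<in> \<Omega> \<Longrightarrow> h z = h' z"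
  shows "in_kernel_span \<Omega> K h'"
  using assms by (auto simp: in_kernel_span_def)

lemma in_kernel_span_zero: "in_kernel_span \<Omega> K (\<lambda>z. 0)"
  unfolding in_kernel_span_def by (rule exI[of _ "{}"]) simp

lemma in_kernel_span_add:
  assumes "in_kernel_span \<Omega> K h" "in_kernel_span \<Omega> K h'"
  shows "in_kernel_span \<Omega> K (\<lambda>z. h z + h' z)"
proof -
  obtain S c where S: "finite S" "S \<subseteq> UNIV \<times> \<Omega>"
    and h: "\<And>z. z \<in> \<Omega> \<Longrightarrow> h z = (\<Sum>(\<alpha>, w)\<in>S. c \<alpha> w * multi_wirtinger_bar \<alpha> (K z) w)"
    using assms(1) by (rule in_kernel_spanE) (rule that)
  obtain S' c' where S': "finite S'" "S' \<subseteq> UNIV \<times> \<Omega>"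
    and h': "\<And>z. z \<in> \<Omega> \<Longrightarrow> h' z = (\<Sum>(\<alpha>, w)\<in>S'. c' \<alpha> w * multi_wirtinger_bar \<alpha> (K z) w)"
    using assms(2) by (rule in_kernel_spanE) (rule that)
  \<comment> \<open>Both coefficient families are cut off to 0 outside their own index sets, since
    their values there are arbitrary.\<close>
  define d where "d \<alpha> w = (if (\<alpha>, w) \<in> S then c \<alpha> w else 0) + (if (\<alpha>, w) \<in> S' then c' \<alpha> w else 0)" for \<alpha> w
  have *: "(\<Sum>(\<alpha>, w)\<in>T. c \<alpha> w * m \<alpha> w) = (\<Sum>(\<alpha>, w)\<in>S \<union> S'. (if (\<alpha>, w) \<in> T then c \<alpha> w else 0) * m \<alpha> w)"
    if "T \<subseteq> S \<union> S'" for T c and m :: "('a \<Rightarrow> nat) \<Rightarrow> complex ^ 'a \<Rightarrow> complex"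
    using S S' that by (intro sum.mono_neutral_cong_left) auto
  have "h z + h' z = (\<Sum>(\<alpha>, w)\<in>S \<union> S'. d \<alpha> w * multi_wirtinger_bar \<alpha> (K z) w)" if "z \<in> \<Omega>" for z
    unfolding h[OF that] h'[OF that] d_def
    by (subst *[of S], simp, subst *[of S'], simp) (simp add: case_prod_unfold distrib_right flip: sum.distrib)
  then show ?thesis
    unfolding in_kernel_span_def using S S' by (intro exI[of _ "S \<union> S'"] exI[of _ d]) auto
qed

lemma in_kernel_span_scale:
  assumes "in_kernel_span \<Omega> K h"
  shows "in_kernel_span \<Omega> K (\<lambda>z. a * h z)"
proof -
  obtain S c where S: "finite S" "S \<subseteq> UNIV \<times> \<Omega>"
    and h: "\<And>z. z \<in> \<Omega> \<Longrightarrow> h z = (\<Sum>(\<alpha>, w)\<in>S. c \<alpha> w * multi_wirtinger_bar \<alpha> (K z) w)"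
    using assms by (rule in_kernel_spanE) (rule that)
  then show ?thesis
    unfolding in_kernel_span_def
    by (intro exI[of _ S] exI[of _ "\<lambda>\<alpha> w. a * c \<alpha> w"]) (auto simp: sum_distrib_left case_prod_unfold mult.assoc)
qed

lemma in_kernel_span_sum:
  assumes "\<And>i. i \<in> I \<Longrightarrow> in_kernel_span \<Omega> K (h i)"
  shows "in_kernel_span \<Omega> K (\<lambda>z. \<Sum>i\<in>I. h i z)"
  using assms
  by (induction I rule: infinite_finite_induct) (auto intro: in_kernel_span_zero in_kernel_span_add)

lemma in_kernel_span_generator:
  assumes "w \<in> \<Omega>"
  shows "in_kernel_span \<Omega> K (\<lambda>z. multi_wirtinger_bar \<alpha> (K z) w)"
  unfolding in_kernel_span_def
  by (rule exI[of _ "{(\<alpha>, w)}"], rule exI[of _ "\<lambda>_ _. 1"]) (use assms in simp)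

lemma in_kernel_span_kernel_cong:
  assumes K: "is_bergman_kernel \<Omega> K" and L: "is_bergman_kernel \<Omega> L" and op: "open \<Omega>"
    and h: "in_kernel_span \<Omega> K h"
  shows "in_kernel_span \<Omega> L h"
proof -
  have "multi_wirtinger_bar \<alpha> (K z) w = multi_wirtinger_bar \<alpha> (L z) w" if z: "z \<in> \<Omega>" and w: "w \<in> \<Omega>" for \<alpha> z w
  proof -
    note hol = bergman_kernel_cnj(2)[OF K z] bergman_kernel_cnj(2)[OF L z]
    show ?thesis
      unfolding multi_wirtinger_bar_def foldr_wirtinger_bar_cnj[OF hol(1) op w] foldr_wirtinger_bar_cnj[OF hol(2) op w]
      by (subst foldr_partial_cn_cong[OF hol(1) op _ w]) (use bergman_kernel_unique[OF K L op z] in auto)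
  qed
  moreover obtain S c where S: "finite S" "S \<subseteq> UNIV \<times> \<Omega>"
    and h: "\<And>z. z \<in> \<Omega> \<Longrightarrow> h z = (\<Sum>(\<alpha>, w)\<in>S. c \<alpha> w * multi_wirtinger_bar \<alpha> (K z) w)"
    using h by (rule in_kernel_spanE) (rule that)
  ultimately have "h z = (\<Sum>(\<alpha>, w)\<in>S. c \<alpha> w * multi_wirtinger_bar \<alpha> (L z) w)" if "z \<in> \<Omega>" for z
    unfolding h[OF that] using that by (intro sum.cong refl) auto
  with S show ?thesis
    unfolding in_kernel_span_def by blast
qed

text \<open>The induction removes the innermost derivative, so that the chain rule is needed for a single
  partial derivative only; the coefficient functions it produces do not depend on \<open>z\<close>.\<close>

lemma in_kernel_span_pullback:
  assumes K: "is_bergman_kernel \<Omega> K" and op: "open \<Omega>" "open V"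
    and g: "holomorphic_map g V" "\<And>y. y \<in> V \<Longrightarrow> g y \<in> \<Omega>" and w: "w \<in> V" and c: "holomorphic_cn c V"
  shows "in_kernel_span \<Omega> K
    (\<lambda>z. cnj (foldr partial_cn js (\<lambda>y. c y * foldr partial_cn b (\<lambda>x. cnj (K z x)) (g y)) w))"
  using c
proof (induction js arbitrary: c b rule: rev_induct)
  case Nil
  show ?case
  proof (rule in_kernel_span_cong)
    show "in_kernel_span \<Omega> K (\<lambda>z. cnj (c w) * multi_wirtinger_bar (count_list b) (K z) (g w))"
      by (intro in_kernel_span_scale in_kernel_span_generator g(2) w)
    show "cnj (c w) * multi_wirtinger_bar (count_list b) (K z) (g w) =
        cnj (foldr partial_cn [] (\<lambda>y. c y * foldr partial_cn b (\<lambda>x. cnj (K z x)) (g y)) w)" if "z \<in> \<Omega>" for z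
      using multi_wirtinger_bar_count_list[OF bergman_kernel_cnj(2)[OF K that] op(1) g(2)[OF w], of b] by simp
  qed
next
  case (snoc j js)
  let ?D = "\<lambda>z b y. foldr partial_cn b (\<lambda>x. cnj (K z x)) (g y)"
  let ?c = "\<lambda>k y. c y * partial_cn j (\<lambda>y. g y $ k) y"
  have hol_c: "holomorphic_cn (?c k) V" for k
    by (intro holomorphic_cn_mult snoc.prems holomorphic_cn_partial_cn holomorphic_map_component g(1) op(2))
  have hol_c': "holomorphic_cn (partial_cn j c) V"
    by (rule holomorphic_cn_partial_cn[OF snoc.prems op(2)])
  show ?case
  proof (rule in_kernel_span_cong)
    \<comment> \<open>The product rule gives the first term and the chain rule the sum. There the
      derivative of \<open>g\<close> joins the coefficient and \<open>k\<close> is put in front of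
      \<open>b\<close>; the induction hypothesis, general in \<open>c\<close> and \<open>b\<close>,
      covers each summand.\<close>
    show "in_kernel_span \<Omega> K (\<lambda>z. cnj (foldr partial_cn js (\<lambda>y. partial_cn j c y * ?D z b y) w) +
        (\<Sum>k\<in>UNIV. cnj (foldr partial_cn js (\<lambda>y. ?c k y * ?D z (k # b) y) w)))"
      by (intro in_kernel_span_add in_kernel_span_sum snoc.IH hol_c hol_c')
    fix z assume z: "z \<in> \<Omega>"
    have G: "holomorphic_cn (foldr partial_cn b (\<lambda>x. cnj (K z x))) \<Omega>" for b
      by (rule holomorphic_cn_foldr[OF bergman_kernel_cnj(2)[OF K z] op(1)])
    have hol_D: "holomorphic_cn (?D z b) V" for b
      by (rule holomorphic_cn_compose[OF G g(1,2)])
    have "partial_cn j (\<lambda>y. c y * ?D z b y) y =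
        partial_cn j c y * ?D z b y + (\<Sum>k\<in>UNIV. ?c k y * ?D z (k # b) y)" if y: "y \<in> V" for y
      unfolding partial_cn_mult[OF snoc.prems hol_D y] partial_cn_compose[OF G g(1) y g(2)[OF y]]
      by (simp add: sum_distrib_left mult_ac)
    then have "foldr partial_cn js (partial_cn j (\<lambda>y. c y * ?D z b y)) w =
        foldr partial_cn js (\<lambda>y. partial_cn j c y * ?D z b y + (\<Sum>k\<in>UNIV. ?c k y * ?D z (k # b) y)) w"
      by (intro foldr_partial_cn_cong[OF _ op(2) _ w] holomorphic_cn_partial_cn holomorphic_cn_mult snoc.prems hol_D op(2))
    also have "\<dots> = foldr partial_cn js (\<lambda>y. partial_cn j c y * ?D z b y) w +
        foldr partial_cn js (\<lambda>y. \<Sum>k\<in>UNIV. ?c k y * ?D z (k # b) y) w"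
      by (intro foldr_partial_cn_add[OF _ _ op(2) w] holomorphic_cn_sum holomorphic_cn_mult[of _ _ "?D z _"] hol_c hol_c' hol_D)
    also have "foldr partial_cn js (\<lambda>y. \<Sum>k\<in>UNIV. ?c k y * ?D z (k # b) y) w =
        (\<Sum>k\<in>UNIV. foldr partial_cn js (\<lambda>y. ?c k y * ?D z (k # b) y) w)"
      by (intro foldr_partial_cn_sum[OF _ op(2) w] holomorphic_cn_mult[of _ _ "?D z _"] hol_c hol_D)
    finally show "cnj (foldr partial_cn js (\<lambda>y. partial_cn j c y * ?D z b y) w) +
        (\<Sum>k\<in>UNIV. cnj (foldr partial_cn js (\<lambda>y. ?c k y * ?D z (k # b) y) w)) =
        cnj (foldr partial_cn (js @ [j]) (\<lambda>y. c y * ?D z b y) w)"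
      by simp
  qed
qed

section \<open>Transport of kernels and spans by a biholomorphism\<close>

context biholomorphic_pair
begin

lemma bergman_pullback:
  assumes "F \<in> bergman_space V"
  shows "(\<lambda>z. u z * F (f z)) \<in> bergman_space \<Omega>"
proof -
  have F: "holomorphic_cn F V" "set_integrable lborel V (\<lambda>w. (cmod (F w))\<^sup>2)"
    using assms by (auto simp: bergman_space_def)
  from change_of_variables(1)[OF F(2)] holomorphic_cn_mult[OF hol_u holomorphic_cn_compose[OF F(1) hol_f f_in]]
  show ?thesis by (simp add: bergman_space_def norm_mult power_mult_distrib)
qed

definition pullback_kernel ::
  "(complex ^ 'n \<Rightarrow> complex ^ 'n \<Rightarrow> complex) \<Rightarrow> complex ^ 'n \<Rightarrow> complex ^ 'n \<Rightarrow> complex" where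
  "pullback_kernel K z w = u z * K (f z) (f w) * cnj (u w)"

text \<open>Each \<open>F\<close> is the pullback of \<open>?G\<close>, its own pullback under the
  inverse. After a change of variables the pairing reproduces \<open>?G\<close> at
  \<open>f z\<close>, and the factor \<open>u z\<close> turns this back into
  \<open>F z\<close>.\<close>

lemma pullback_kernel_is_bergman_kernel:
  assumes K: "is_bergman_kernel V K"
  shows "is_bergman_kernel \<Omega> (pullback_kernel K)"
  unfolding is_bergman_kernel_def
proof (intro conjI ballI)
  interpret inv: biholomorphic_pair V \<Omega> g f by (rule inverse_pair)
  show "holomorphic_cn (\<lambda>z. pullback_kernel K z w) \<Omega>" if "w \<in> \<Omega>" for w
    unfolding pullback_kernel_def
    by (intro holomorphic_cn_mult hol_u holomorphic_cn_const holomorphic_cn_compose[OF _ hol_f f_in, of "\<lambda>z. K z (f w)"])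
      (use K f_in[OF that] in \<open>auto simp: is_bergman_kernel_def\<close>)
  show "(\<lambda>w. cnj (pullback_kernel K z w)) \<in> bergman_space \<Omega>" if "z \<in> \<Omega>" for z
    using bergman_scale[OF bergman_pullback[OF bergman_kernel_cnj(1)[OF K f_in[OF that]]], of "cnj (u z)"]
    by (simp add: pullback_kernel_def mult_ac)
  fix F z assume F: "F \<in> bergman_space \<Omega>" and z: "z \<in> \<Omega>"
  let ?G = "\<lambda>y. u' y * F (g y)"
  have G: "?G \<in> bergman_space V" by (rule inv.bergman_pullback[OF F])
  have "set_integrable lborel V (\<lambda>y. ?G y * cnj (cnj (K (f z) y)))"
    by (rule bergman_mult_integrable[OF G bergman_kernel_cnj(1)[OF K f_in[OF z]] open_img])
  then have int: "set_integrable lborel V (\<lambda>y. ?G y * K (f z) y)" by simp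
  have u': "(cmod (u w))\<^sup>2 *\<^sub>R (?G (f w) * K (f z) (f w)) = F w * K (f z) (f w) * cnj (u w)" if "w \<in> \<Omega>" for w
  proof -
    have "(cmod (u w))\<^sup>2 *\<^sub>R (?G (f w) * K (f z) (f w)) = (u' (f w) * u w) * (F w * K (f z) (f w) * cnj (u w))"
      unfolding scaleR_conv_of_real complex_norm_square using gf[OF that] by simp
    then show ?thesis by (simp only: u'_u[OF that] mult_1)
  qed
  have "(LINT w:\<Omega>|lborel. F w * pullback_kernel K z w)
      = (LINT w:\<Omega>|lborel. u z * ((cmod (u w))\<^sup>2 *\<^sub>R (?G (f w) * K (f z) (f w))))"
    using open_dom
    by (intro set_lebesgue_integral_cong) (auto simp: u' pullback_kernel_def simp del: scaleR_conv_of_real)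
  also have "\<dots> = u z * (LINT y:V|lborel. ?G y * K (f z) y)"
    unfolding change_of_variables(2)[OF int] by (rule set_integral_mult_right)
  also have "\<dots> = u z * ?G (f z)"
    using K G f_in[OF z] by (simp add: is_bergman_kernel_def)
  also have "\<dots> = (u' (f z) * u z) * F z"
    using gf[OF z] by simp
  also have "\<dots> = F z"
    by (simp only: u'_u[OF z] mult_1)
  finally show "(LINT w:\<Omega>|lborel. F w * pullback_kernel K z w) = F z" .
qed

lemma bergman_span_pullback:
  assumes "h \<in> bergman_span V"
  shows "(\<lambda>z. u z * h (f z)) \<in> bergman_span \<Omega>"
proof -
  obtain K where K: "is_bergman_kernel V K" and hK: "in_kernel_span V K h"
    using assms by (auto simp: bergman_span_iff)
  let ?K = "pullback_kernel K"
  note K' = pullback_kernel_is_bergman_kernel[OF K]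
  obtain S c where S: "finite S" "S \<subseteq> UNIV \<times> V"
    and h: "\<And>z. z \<in> V \<Longrightarrow> h z = (\<Sum>(\<alpha>, w)\<in>S. c \<alpha> w * multi_wirtinger_bar \<alpha> (K z) w)"
    using hK by (rule in_kernel_spanE) (rule that)
  have gen: "in_kernel_span \<Omega> ?K (\<lambda>z. u z * multi_wirtinger_bar \<alpha> (K (f z)) w)" if w: "w \<in> V" for \<alpha> w
  proof -
    obtain js where js: "\<And>g \<Omega> z. \<lbrakk>holomorphic_cn (\<lambda>w. cnj (g w)) \<Omega>; open \<Omega>; z \<in> \<Omega>\<rbrakk> \<Longrightarrow>
       multi_wirtinger_bar \<alpha> g z = cnj (foldr partial_cn js (\<lambda>w. cnj (g w)) z)"
      using multi_wirtinger_bar_cnj by metis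
    have hol_u': "holomorphic_cn u' V" by (rule holomorphic_cn_jacobian_det[OF hol_g open_img])
    show ?thesis
    proof (rule in_kernel_span_cong)
      \<comment> \<open>The transformation law solved for the kernel of \<open>V\<close> and
        conjugated: the initial coefficient is \<open>u'\<close>, and \<open>b\<close> is empty
        because no derivative has yet been taken of the kernel of the domain.\<close>
      show "in_kernel_span \<Omega> ?K (\<lambda>z. cnj (foldr partial_cn js (\<lambda>y. u' y * foldr partial_cn [] (\<lambda>x. cnj (?K z x)) (g y)) w))"
        by (rule in_kernel_span_pullback[OF K' open_dom open_img hol_g g_in w hol_u'])
      fix z assume z: "z \<in> \<Omega>"
      note holK = bergman_kernel_cnj(2)[OF K f_in[OF z]]
      have "u' y * cnj (?K z (g y)) = cnj (u z) * cnj (K (f z) y)" if y: "y \<in> V" for y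
      proof -
        have "u' y * cnj (?K z (g y)) = (u (g y) * u' y) * (cnj (u z) * cnj (K (f z) y))"
          by (simp add: pullback_kernel_def fg[OF y])
        then show ?thesis by (simp only: u_u'[OF y] mult_1)
      qed
      then have "foldr partial_cn js (\<lambda>y. cnj (u z) * cnj (K (f z) y)) w = foldr partial_cn js (\<lambda>y. u' y * cnj (?K z (g y))) w"
        by (intro foldr_partial_cn_cong[OF holomorphic_cn_mult[OF holomorphic_cn_const holK] open_img _ w]) simp
      then have "foldr partial_cn js (\<lambda>y. u' y * cnj (?K z (g y))) w = cnj (u z) * foldr partial_cn js (\<lambda>y. cnj (K (f z) y)) w"
        by (simp only: foldr_partial_cn_cmult[OF holK open_img w])
      then show "cnj (foldr partial_cn js (\<lambda>y. u' y * foldr partial_cn [] (\<lambda>x. cnj (?K z x)) (g y)) w)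
          = u z * multi_wirtinger_bar \<alpha> (K (f z)) w"
        by (simp add: js[OF holK open_img w])
    qed
  qed
  have "in_kernel_span \<Omega> ?K (\<lambda>z. \<Sum>p\<in>S. c (fst p) (snd p) * (u z * multi_wirtinger_bar (fst p) (K (f z)) (snd p)))"
    using S(2) by (intro in_kernel_span_sum in_kernel_span_scale gen) auto
  then have "in_kernel_span \<Omega> ?K (\<lambda>z. u z * h (f z))"
    by (rule in_kernel_span_cong) (simp add: h f_in sum_distrib_left case_prod_unfold mult_ac)
  with K' show ?thesis by (auto simp: bergman_span_iff)
qed

end

lemma bergman_span_cong:
  assumes "h \<in> bergman_span \<Omega>" "\<And>z. z \<in> \<Omega> \<Longrightarrow> h z = h' z"
  shows "h' \<in> bergman_span \<Omega>"
  using assms in_kernel_span_cong unfolding bergman_span_iff by blast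

lemma polynomial_in_bergman_span:
  assumes op: "open \<Omega>" and mono: "\<And>\<alpha>. monomial_cn \<alpha> \<in> bergman_span \<Omega>" and p: "polynomial_cn p"
  shows "p \<in> bergman_span \<Omega>"
proof -
  obtain A c where p: "p = (\<lambda>z. \<Sum>\<alpha>\<in>A. c \<alpha> * monomial_cn \<alpha> z)"
    using p by (auto simp: polynomial_cn_def)
  obtain K where K: "is_bergman_kernel \<Omega> K"
    using mono by (auto simp: bergman_span_iff)
  have "in_kernel_span \<Omega> K (monomial_cn \<alpha>)" for \<alpha>
    using mono[of \<alpha>] in_kernel_span_kernel_cong[OF _ K op] by (auto simp: bergman_span_iff)
  then have "in_kernel_span \<Omega> K p"
    unfolding p by (intro in_kernel_span_sum in_kernel_span_scale)
  with K show ?thesis by (auto simp: bergman_span_iff)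
qed

lemma polynomial_monomial: "polynomial_cn (monomial_cn \<alpha>)"
  unfolding polynomial_cn_def by (rule exI[of _ "{\<alpha>}"], rule exI[of _ "\<lambda>_. 1"]) simp

theorem theorem3p2:
  fixes \<Omega> V :: "(complex ^ 'n) set" and f :: "complex ^ 'n \<Rightarrow> complex ^ 'n"
  assumes "domain_cn \<Omega>" and "finite_volume \<Omega>"
    and "domain_cn V" and "finite_volume V"
    and "biholomorphism f \<Omega> V"
  shows "QDP V \<longleftrightarrow>
    (\<forall>\<alpha> :: 'n \<Rightarrow> nat. (\<lambda>z. jacobian_det f z * (\<Prod>i\<in>UNIV. (f z $ i) ^ \<alpha> i)) \<in> bergman_span \<Omega>)"
proof -
  let ?g = "inv_into \<Omega> f"
  interpret biholomorphic_pair \<Omega> V f ?g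
    using assms by unfold_locales (auto simp: domain_cn_def finite_volume_def biholomorphism_def bij_betw_def
      intro: inv_into_into f_inv_into_f)
  interpret inv: biholomorphic_pair V \<Omega> ?g f by (rule inverse_pair)
  show ?thesis
  proof
    assume "QDP V"
    then have "monomial_cn \<alpha> \<in> bergman_span V" for \<alpha>
      using polynomial_monomial by (auto simp: QDP_def)
    from bergman_span_pullback[OF this]
    show "\<forall>\<alpha> :: 'n \<Rightarrow> nat. (\<lambda>z. jacobian_det f z * (\<Prod>i\<in>UNIV. (f z $ i) ^ \<alpha> i)) \<in> bergman_span \<Omega>"
      by (simp add: monomial_cn_def)
  next
    assume *: "\<forall>\<alpha> :: 'n \<Rightarrow> nat. (\<lambda>z. jacobian_det f z * (\<Prod>i\<in>UNIV. (f z $ i) ^ \<alpha> i)) \<in> bergman_span \<Omega>"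
    have mono: "monomial_cn \<alpha> \<in> bergman_span V" for \<alpha>
    proof (rule bergman_span_cong)
      \<comment> \<open>Pulling the hypothesis back along the inverse leaves the product of the two
        Jacobian determinants at corresponding points, which is 1 on \<open>V\<close>.\<close>
      show "(\<lambda>w. jacobian_det ?g w * (jacobian_det f (?g w) * (\<Prod>i\<in>UNIV. (f (?g w) $ i) ^ \<alpha> i))) \<in> bergman_span V"
        by (rule inv.bergman_span_pullback) (use * in blast)
      fix w assume w: "w \<in> V"
      have "jacobian_det ?g w * (jacobian_det f (?g w) * (\<Prod>i\<in>UNIV. (f (?g w) $ i) ^ \<alpha> i)) =
          (jacobian_det f (?g w) * jacobian_det ?g w) * monomial_cn \<alpha> w"
        by (simp add: fg[OF w] monomial_cn_def)
      then show "jacobian_det ?g w * (jacobian_det f (?g w) * (\<Prod>i\<in>UNIV. (f (?g w) $ i) ^ \<alpha> i)) = monomial_cn \<alpha> w"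
        by (simp only: u_u'[OF w] mult_1)
    qed
    then have "\<forall>p. polynomial_cn p \<longrightarrow> p \<in> bergman_span V"
      using polynomial_in_bergman_span[OF open_img] by blast
    moreover have "(\<lambda>z :: complex ^ 'n. 1) = monomial_cn (\<lambda>_. 0)"
      by (simp add: fun_eq_iff monomial_cn_def)
    ultimately show "QDP V"
      using assms(3,4) mono[of "\<lambda>_. 0"] by (simp add: QDP_def quadrature_domain_def)
  qed
qed

end
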